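(* Let $m\ge 2$ and let $n_1\le n_2\le\cdots\le n_m$ be positive integers. Let $G=K_{n_1,\dots,n_m}$ be the complete multipartite graph with part sizes $n_1,\dots,n_m$, and let $\mathrm{PF}_t(G)$ denote its $t$-path-free complex. For every integer $t\ge 2$, the following statements are equivalent: (1) $t\ge 2n_{m-1}-1$; (2) $\mathrm{PF}_t(G)$ is vertex decomposable; (3) $\mathrm{PF}_t(G)$ is shellable; (4) $\mathrm{PF}_t(G)$ is sequentially Cohen-Macaulay (over a field $\mathbb{K}$).
   Context: Complete multipartite graph: $K_{n_1,\dots,n_m}$ has vertex set $V=V_1\sqcup\cdots\sqcup V_m$ with $|V_i|=n_i$, and two vertices are adjacent if and only if they lie in different parts $V_i$, $V_j$ with $i\ne j$. Path-free complex: $P_t$ is the path on $t$ vertices. For a graph $G$ and a positive integer $t$, $\mathrm{PF}_t(G)$ is the simplicial complex on $V(G)$ whose faces are the subsets $F\subseteq V(G)$ such that the induced subgraph $G[F]$ contains no subgraph (not necessarily induced) isomorphic to $P_t$. Simplicial complexes: an (abstract) simplicial complex $\Delta$ on a finite set is a collection of subsets closed under taking subsets; maximal faces are facets; $\dim F=|F|-1$. The void complex $\emptyset$ has no faces; the empty complex $\{\emptyset\}$ has only the empty face. A simplex is a complex with a unique facet. For a face $F$ of $\Delta$: $\mathrm{lk}_\Delta(F)=\{F'\in\Delta: F\cap F'=\emptyset,\ F\cup F'\in\Delta\}$, and $\mathrm{fdel}_\Delta(F)=\{F'\in\Delta: F\not\subseteq F'\}$. For a vertex $v$: $\mathrm{lk}_\Delta(v)=\mathrm{lk}_\Delta(\{v\})$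 and $\mathrm{del}_\Delta(v)=\{F'\in\Delta: v\notin F'\}$. Vertex decomposable (recursive): $\Delta$ is vertex decomposable if either $\Delta$ is a simplex (including $\emptyset$ and $\{\emptyset\}$), or there is a vertex $v$ such that $\mathrm{lk}_\Delta(v)$ and $\mathrm{del}_\Delta(v)$ are both vertex decomposable and every facet of $\mathrm{del}_\Delta(v)$ is a facet of $\Delta$. Shellable (recursive; equivalent to the classical non-pure definition by facet orderings): $\Delta$ is shellable if either $\Delta$ is a simplex (including $\emptyset$ and $\{\emptyset\}$), or there is a face $F$ such that $\mathrm{lk}_\Delta(F)$ and $\mathrm{fdel}_\Delta(F)$ are both shellable and every facet of $\mathrm{fdel}_\Delta(F)$ is a facet of $\Delta$. Cohen-Macaulay: $\Delta$ is Cohen-Macaulay over a field $\mathbb{K}$ if $\widetilde H_i(\mathrm{lk}_\Delta(\sigma);\mathbb{K})=0$ for all $\sigma\in\Delta$ and all $i<\dim\mathrm{lk}_\Delta(\sigma)$. Sequentially Cohen-Macaulay: $\Delta$ is sequentially Cohen-Macaulay over $\mathbb{K}$ if for every $d\ge 0$ its pure $d$-skeleton $\Delta^{[d]}$, i.e. the subcomplex whose facets are precisely the $d$-dimensional faces of $\Delta$, is Cohen-Macaulay over $\mathbb{K}$. The field $\mathbb{K}$ is arbitrary and fixed. *)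

theory Defs
  imports "HOL-Algebra.Elementary_Groups" "HOL-Library.Disjoint_Sets"
begin

section \<open>Graphs\<close>

type_synonym 'a graph = "'a set \<times> 'a set set"

abbreviation verts :: "'a graph \<Rightarrow> 'a set" where
  "verts G \<equiv> fst G"

abbreviation edges :: "'a graph \<Rightarrow> 'a set set" where
  "edges G \<equiv> snd G"

definition simple_graph :: "'a graph \<Rightarrow> bool" where
  "simple_graph G \<longleftrightarrow> finite (verts G) \<and> (\<forall>e\<in>edges G. e \<subseteq> verts G \<and> card e = 2)"

definition is_subgraph :: "'a graph \<Rightarrow> 'a graph \<Rightarrow> bool" where
  "is_subgraph H G \<longleftrightarrow> simple_graph H \<and> verts H \<subseteq> verts G \<and> edges H \<subseteq> edges G"

definition induced_subgraph :: "'a graph \<Rightarrow> 'a set \<Rightarrow> 'a graph" where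
  "induced_subgraph G F = (F, {e \<in> edges G. e \<subseteq> F})"

definition graph_isomorphic :: "'a graph \<Rightarrow> 'b graph \<Rightarrow> bool" where
  "graph_isomorphic G H \<longleftrightarrow>
     (\<exists>f. bij_betw f (verts G) (verts H) \<and>
          (\<forall>x\<in>verts G. \<forall>y\<in>verts G. {x, y} \<in> edges G \<longleftrightarrow> {f x, f y} \<in> edges H))"

text \<open>The index counts vertices, not edges.\<close>

definition path_graph :: "nat \<Rightarrow> nat graph" where
  "path_graph t = ({..<t}, {{i, Suc i} | i. Suc i < t})"

definition complete_multipartite :: "nat \<Rightarrow> (nat \<Rightarrow> 'a set) \<Rightarrow> 'a graph" where
  "complete_multipartite m V =
     (\<Union>i\<in>{1..m}. V i,
      {{x, y} | x y. \<exists>i\<in>{1..m}. \<exists>j\<in>{1..m}. i \<noteq> j \<and> x \<in> V i \<and> y \<in> V j})"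


section \<open>Simplicial complexes\<close>

text \<open>
  A complex is represented by its set of faces. The void complex is the empty set,
  while the set containing only the empty face is a different complex.
  Elements of the ground set need not be vertices.
\<close>

definition simplicial_complex :: "'a set set \<Rightarrow> bool" where
  "simplicial_complex \<Delta> \<longleftrightarrow> finite (\<Union>\<Delta>) \<and> (\<forall>F\<in>\<Delta>. \<forall>F'. F' \<subseteq> F \<longrightarrow> F' \<in> \<Delta>)"

definition facets :: "'a set set \<Rightarrow> 'a set set" where
  "facets \<Delta> = {F \<in> \<Delta>. \<forall>F'\<in>\<Delta>. F \<subseteq> F' \<longrightarrow> F' = F}"

definition is_simplex :: "'a set set \<Rightarrow> bool" where
  "is_simplex \<Delta> \<longleftrightarrow> simplicial_complex \<Delta> \<and> (\<Delta> = {} \<or> (\<exists>!F. F \<in> facets \<Delta>))"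

definition link :: "'a set set \<Rightarrow> 'a set \<Rightarrow> 'a set set" where
  "link \<Delta> F = {F' \<in> \<Delta>. F \<inter> F' = {} \<and> F \<union> F' \<in> \<Delta>}"

definition face_deletion :: "'a set set \<Rightarrow> 'a set \<Rightarrow> 'a set set" where
  "face_deletion \<Delta> F = {F' \<in> \<Delta>. \<not> F \<subseteq> F'}"

definition vertex_deletion :: "'a set set \<Rightarrow> 'a \<Rightarrow> 'a set set" where
  "vertex_deletion \<Delta> v = {F' \<in> \<Delta>. v \<notin> F'}"

inductive vertex_decomposable :: "'a set set \<Rightarrow> bool" where
  simplex: "is_simplex \<Delta> \<Longrightarrow> vertex_decomposable \<Delta>"
| shedding: "\<lbrakk>simplicial_complex \<Delta>; {v} \<in> \<Delta>;
     vertex_decomposable (link \<Delta> {v}); vertex_decomposable (vertex_deletion \<Delta> v);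
     facets (vertex_deletion \<Delta> v) \<subseteq> facets \<Delta>\<rbrakk> \<Longrightarrow> vertex_decomposable \<Delta>"

text \<open>
  For the empty face the second rule below is circular (the link is \<open>\<Delta>\<close> itself), so in the least
  fixed point it contributes nothing.
\<close>

inductive shellable :: "'a set set \<Rightarrow> bool" where
  simplex: "is_simplex \<Delta> \<Longrightarrow> shellable \<Delta>"
| shedding: "\<lbrakk>simplicial_complex \<Delta>; F \<in> \<Delta>;
     shellable (link \<Delta> F); shellable (face_deletion \<Delta> F);
     facets (face_deletion \<Delta> F) \<subseteq> facets \<Delta>\<rbrakk> \<Longrightarrow> shellable \<Delta>"

definition face_dim :: "'a set \<Rightarrow> int" where
  "face_dim F = int (card F) - 1"

text \<open>Only meaningful for finite nonvoid complexes.\<close>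

definition complex_dim :: "'a set set \<Rightarrow> int" where
  "complex_dim \<Delta> = Max (face_dim ` \<Delta>)"

definition pure_skeleton :: "nat \<Rightarrow> 'a set set \<Rightarrow> 'a set set" where
  "pure_skeleton d \<Delta> = {F. \<exists>F'\<in>\<Delta>. face_dim F' = int d \<and> F \<subseteq> F'}"


section \<open>Reduced simplicial homology over a field\<close>

text \<open>
  A chain is identified with its coefficient function. Faces are oriented by the linear order on the
  ambient type: the oriented face \<open>[v\<^sub>0, \<dots>, v\<^sub>i]\<close> has \<open>v\<^sub>0 < \<dots> < v\<^sub>i\<close>, so that the sign
  \<open>(- 1) ^ j\<close> belonging to \<open>v\<^sub>j\<close> has exponent \<open>card {u \<in> F. u < v\<^sub>j}\<close>.
  The empty face spans the chains of degree \<open>- 1\<close>, which makes the homology reduced.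
\<close>

definition chains :: "'a set set \<Rightarrow> int \<Rightarrow> ('a set \<Rightarrow> 'k::field) set" where
  "chains \<Delta> i = {c. \<forall>F. c F \<noteq> 0 \<longrightarrow> F \<in> \<Delta> \<and> face_dim F = i}"

definition boundary_map :: "'a::linorder set set \<Rightarrow> ('a set \<Rightarrow> 'k::field) \<Rightarrow> 'a set \<Rightarrow> 'k" where
  "boundary_map \<Delta> c = (\<lambda>F'. \<Sum>F\<in>\<Delta>. \<Sum>v\<in>F.
     if F' = F - {v} then (- 1) ^ card {u \<in> F. u < v} * c F else 0)"

definition cycle_group :: "'a::linorder set set \<Rightarrow> int \<Rightarrow> ('a set \<Rightarrow> 'k::field) monoid" where
  "cycle_group \<Delta> i =
     \<lparr>carrier = {c \<in> chains \<Delta> i. boundary_map \<Delta> c = (\<lambda>_. 0)},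
      mult = (\<lambda>c c' F. c F + c' F), one = (\<lambda>_. 0)\<rparr>"

definition boundaries :: "'a::linorder set set \<Rightarrow> int \<Rightarrow> ('a set \<Rightarrow> 'k::field) set" where
  "boundaries \<Delta> i = boundary_map \<Delta> ` chains \<Delta> (i + 1)"

text \<open>
  Only the additive group of the \<open>'k\<close>-vector space \<open>Z\<^sub>i / B\<^sub>i\<close> is recorded; this suffices to say that
  the homology vanishes.
\<close>

definition reduced_homology ::
    "'k::field itself \<Rightarrow> 'a::linorder set set \<Rightarrow> int \<Rightarrow> ('a set \<Rightarrow> 'k) set monoid" where
  "reduced_homology K \<Delta> i = cycle_group \<Delta> i Mod boundaries \<Delta> i"

definition cohen_macaulay :: "'k::field itself \<Rightarrow> 'a::linorder set set \<Rightarrow> bool" where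
  "cohen_macaulay K \<Delta> \<longleftrightarrow>
     (\<forall>\<sigma>\<in>\<Delta>. \<forall>i < complex_dim (link \<Delta> \<sigma>). trivial_group (reduced_homology K (link \<Delta> \<sigma>) i))"

definition sequentially_cohen_macaulay :: "'k::field itself \<Rightarrow> 'a::linorder set set \<Rightarrow> bool" where
  "sequentially_cohen_macaulay K \<Delta> \<longleftrightarrow> (\<forall>d. cohen_macaulay K (pure_skeleton d \<Delta>))"


section \<open>Path-free complexes\<close>

definition path_free_complex :: "nat \<Rightarrow> 'a graph \<Rightarrow> 'a set set" where
  "path_free_complex t G =
     {F. F \<subseteq> verts G \<and>
         \<not> (\<exists>H. is_subgraph H (induced_subgraph G F) \<and> graph_isomorphic (path_graph t) H)}"

end

theory Submission
  imports Defs
begin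

text \<open>
  In a complete multipartite graph, a path cannot stay in the same part for two consecutive vertices,
  and a greedy construction shows that this is the only obstruction to long paths. So a vertex set
  \<open>F\<close> is free of paths on \<open>t\<close> vertices iff it has fewer than \<open>t\<close> elements or has fewer than
  \<open>h = t div 2\<close> elements outside some part \<open>V i\<close>
  (\<open>path_free_complex_multipartite\<close>). A face of the second kind that is not of the first kind needs a
  part with more than \<open>t - h\<close> elements, and the condition \<open>t \<ge> 2 * n (m - 1) - 1\<close> says precisely that no
  part other than the largest one \<open>V m\<close> has so many.

  If the condition holds, the faces are therefore the sets with at most \<open>t - 1\<close> elements, or with
  fewer than \<open>h\<close> elements outside \<open>V m\<close>. Complexes of this form are closed under links and deletions of
  vertices outside \<open>V m\<close>, and these vertices are shedding vertices unless the complex is a simplex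
  (\<open>vertex_decomposable_bounded_complex\<close>). Moreover, their nonvoid pure skeletons are matroid complexes, which
  are Cohen--Macaulay by a Mayer-Vietoris argument for the deletion and the link of a vertex; so these
  complexes are sequentially Cohen--Macaulay as well
  (\<open>sequentially_cohen_macaulay_bounded_complex\<close>). The implication from vertex decomposability to
  shellability holds in general.

  If the condition fails, \<open>V (m - 1)\<close> and \<open>V m\<close> both have more than \<open>t - h\<close> elements. Then the faces with
  \<open>t\<close> elements fall into several kinds, according to the part that contains most of their elements, and
  faces of different kinds never share \<open>t - 1\<close> elements. This contradicts shellability, because the pure
  skeletons of a shellable complex are strongly connected (\<open>shellable_strongly_connected\<close>). It also
  contradicts sequential Cohen--Macaulayness, because the pure skeleton of dimension \<open>t - 1\<close> has a
  disconnected link of positive dimension, that of a face with \<open>h - 1\<close> elements in each of the two parts.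
\<close>

section \<open>Paths in complete multipartite graphs\<close>

lemma contains_path_iff:
  "(\<exists>H. is_subgraph H G \<and> graph_isomorphic (path_graph t) H) \<longleftrightarrow>
   (\<exists>f. inj_on f {..<t} \<and> f ` {..<t} \<subseteq> verts G \<and> (\<forall>i. Suc i < t \<longrightarrow> {f i, f (Suc i)} \<in> edges G))"
    (is "?L \<longleftrightarrow> ?R")
proof
  assume ?L
  then obtain H f where H: "is_subgraph H G" and f: "bij_betw f {..<t} (verts H)"
    and e: "\<forall>x<t. \<forall>y<t. {x, y} \<in> edges (path_graph t) \<longleftrightarrow> {f x, f y} \<in> edges H"
    unfolding graph_isomorphic_def path_graph_def by auto
  have "{f i, f (Suc i)} \<in> edges G" if "Suc i < t" for i
  proof -
    have "{i, Suc i} \<in> edges (path_graph t)"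
      using that unfolding path_graph_def by auto
    then show ?thesis
      using e H that by (auto simp: is_subgraph_def)
  qed
  moreover have "inj_on f {..<t}" "f ` {..<t} \<subseteq> verts G"
    using f H by (simp_all add: bij_betw_def is_subgraph_def)
  ultimately show ?R by (intro exI[of _ f]) simp
next
  assume ?R
  then obtain f where inj: "inj_on f {..<t}" and im: "f ` {..<t} \<subseteq> verts G"
    and e: "\<forall>i. Suc i < t \<longrightarrow> {f i, f (Suc i)} \<in> edges G" by blast
  define H where "H = (f ` {..<t}, {{f i, f (Suc i)} | i. Suc i < t})"
  have "f i \<noteq> f (Suc i)" if "Suc i < t" for i
    using inj_onD[OF inj, of i "Suc i"] that by auto
  then have "is_subgraph H G"
    using im e unfolding is_subgraph_def H_def simple_graph_def by auto
  moreover have "{x, y} \<in> edges (path_graph t) \<longleftrightarrow> {f x, f y} \<in> edges H"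
    if "x < t" "y < t" for x y
  proof
    assume "{x, y} \<in> edges (path_graph t)"
    then obtain i where "{x, y} = {i, Suc i}" "Suc i < t" unfolding path_graph_def by auto
    then have "{f x, f y} = {f i, f (Suc i)}" by (auto simp: doubleton_eq_iff)
    then show "{f x, f y} \<in> edges H" using \<open>Suc i < t\<close> unfolding H_def by auto
  next
    assume "{f x, f y} \<in> edges H"
    then obtain i where i: "{f x, f y} = {f i, f (Suc i)}" "Suc i < t" unfolding H_def by auto
    then have "{x, y} = {i, Suc i}"
      using inj that unfolding doubleton_eq_iff inj_on_def by (metis Suc_lessD lessThan_iff)
    then show "{x, y} \<in> edges (path_graph t)" using i(2) unfolding path_graph_def by auto
  qed
  ultimately show ?L
    using inj unfolding graph_isomorphic_def
    by (intro exI[of _ H] conjI exI[of _ f]) (auto simp: bij_betw_def H_def path_graph_def)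
qed

lemma contains_path_induced_iff:
  "(\<exists>H. is_subgraph H (induced_subgraph G F) \<and> graph_isomorphic (path_graph t) H) \<longleftrightarrow>
   (\<exists>f. inj_on f {..<t} \<and> f ` {..<t} \<subseteq> F \<and> (\<forall>i. Suc i < t \<longrightarrow> {f i, f (Suc i)} \<in> edges G))"
proof -
  have sub: "{f i, f (Suc i)} \<subseteq> F" if "f ` {..<t} \<subseteq> F" "Suc i < t" for f i
    using that by auto
  have "(inj_on f {..<t} \<and> f ` {..<t} \<subseteq> F \<and>
        (\<forall>i. Suc i < t \<longrightarrow> {f i, f (Suc i)} \<in> edges G \<and> {f i, f (Suc i)} \<subseteq> F)) \<longleftrightarrow>
      (inj_on f {..<t} \<and> f ` {..<t} \<subseteq> F \<and> (\<forall>i. Suc i < t \<longrightarrow> {f i, f (Suc i)} \<in> edges G))" for f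
    using sub[of f] by (intro conj_cong refl) simp
  then show ?thesis
    by (simp only: contains_path_iff induced_subgraph_def fst_conv snd_conv mem_Collect_eq)
qed

text \<open>
  A greedy construction: always continue with a vertex of a most frequent colour among those
  different from the current one. The bounds on the colour classes survive the removal of this
  vertex, because a colour other than the current one that is not removed is at most as frequent as the
  removed one, and so fills at most half of the set. Forbidding the
  colour \<open>i\<close> for the first vertex is what makes the induction go through.
\<close>

lemma ex_properly_coloured_list:
  fixes col :: "'a \<Rightarrow> 'c"
  assumes "finite F" "t \<le> card F" "\<And>j. t div 2 \<le> card {x \<in> F. col x \<noteq> j}"
    "(t + 1) div 2 \<le> card {x \<in> F. col x \<noteq> i}"
  shows "\<exists>xs. length xs = t \<and> distinct xs \<and> set xs \<subseteq> F \<and>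
    successively (\<lambda>x y. col x \<noteq> col y) xs \<and> (xs \<noteq> [] \<longrightarrow> col (hd xs) \<noteq> i)"
  using assms
proof (induction t arbitrary: F i)
  case 0
  show ?case by (intro exI[of _ "[]"]) auto
next
  case (Suc t)
  define cls where "cls j = {x \<in> F. col x = j}" for j
  have fin: "finite (cls j)" for j using Suc.prems(1) by (auto simp: cls_def)
  have split: "card {x \<in> F. col x \<noteq> j} + card (cls j) = card F" for j
  proof -
    have "card ({x \<in> F. col x \<noteq> j} \<union> cls j) = card {x \<in> F. col x \<noteq> j} + card (cls j)"
      using Suc.prems(1) by (intro card_Un_disjoint) (auto simp: cls_def)
    moreover have "{x \<in> F. col x \<noteq> j} \<union> cls j = F" by (auto simp: cls_def)
    ultimately show ?thesis by simp
  qed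
  let ?J = "col ` {x \<in> F. col x \<noteq> i}"
  have "{x \<in> F. col x \<noteq> i} \<noteq> {}" using Suc.prems(4) by fastforce
  then have J: "finite ((card \<circ> cls) ` ?J)" "(card \<circ> cls) ` ?J \<noteq> {}" using Suc.prems(1) by auto
  from Max_in[OF J] have "\<exists>j\<in>?J. Max ((card \<circ> cls) ` ?J) = card (cls j)"
    unfolding image_iff comp_def by simp
  then obtain j where j: "j \<in> ?J" "card (cls j) = Max ((card \<circ> cls) ` ?J)" by metis
  have max: "card (cls k) \<le> card (cls j)" if "k \<noteq> i" for k
  proof (cases "k \<in> ?J")
    case True
    then show ?thesis using Max_ge[OF J(1), of "card (cls k)"] j(2) by auto
  next
    case False
    then have "cls k = {}" using that by (auto simp: cls_def)
    then show ?thesis by simp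
  qed
  from j obtain x where x: "x \<in> F" "col x = j" "j \<noteq> i" by auto
  let ?F = "F - {x}"
  have cardj: "card {y \<in> ?F. col y \<noteq> j} = card {y \<in> F. col y \<noteq> j}"
    using x by (intro arg_cong[of _ _ card]) auto
  have cardk: "card {y \<in> ?F. col y \<noteq> k} = card {y \<in> F. col y \<noteq> k} - 1" if "k \<noteq> j" for k
  proof -
    have "{y \<in> ?F. col y \<noteq> k} = {y \<in> F. col y \<noteq> k} - {x}" by auto
    then show ?thesis using x that by simp
  qed
  have "t div 2 \<le> card {y \<in> ?F. col y \<noteq> k}" for k
  proof (cases "k = j")
    case True
    then show ?thesis using cardj Suc.prems(3)[of j] by simp
  next
    case False
    show ?thesis
    proof (cases "k = i")
      case True
      then show ?thesis using cardk[OF False] Suc.prems(4) by simp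
    next
      case ki: False
      have "card (cls j) \<le> card {y \<in> F. col y \<noteq> k}"
        using False Suc.prems(1) by (intro card_mono) (auto simp: cls_def)
      then have "Suc t \<le> 2 * card {y \<in> F. col y \<noteq> k}"
        using split[of k] max[OF ki] Suc.prems(2) by linarith
      then show ?thesis using cardk[OF False] by linarith
    qed
  qed
  moreover have "(t + 1) div 2 \<le> card {y \<in> ?F. col y \<noteq> j}"
    using cardj Suc.prems(3)[of j] by simp
  moreover have "t \<le> card ?F" using x Suc.prems(1,2) by simp
  ultimately obtain xs where xs: "length xs = t" "distinct xs" "set xs \<subseteq> ?F"
    "successively (\<lambda>x y. col x \<noteq> col y) xs" "xs \<noteq> [] \<longrightarrow> col (hd xs) \<noteq> j"
    using Suc.IH[of ?F j] Suc.prems(1) by auto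
  then show ?case
    using x by (intro exI[of _ "x # xs"]) (auto simp: successively_Cons)
qed

text \<open>
  Each of the \<open>t div 2\<close> disjoint edges \<open>{f 0, f 1}, {f 2, f 3}, \<dots>\<close> of the path has an endpoint outside
  the independent set \<open>W\<close>.
\<close>

lemma path_leaves_independent_set:
  assumes "inj_on f {..<t}" "f ` {..<t} \<subseteq> F" "finite F"
    "\<And>i. Suc i < t \<Longrightarrow> f i \<notin> W \<or> f (Suc i) \<notin> W"
  shows "t div 2 \<le> card (F - W)"
proof -
  define g where "g k = (if f (2 * k) \<notin> W then 2 * k else 2 * k + 1)" for k
  have g: "g k < t \<and> f (g k) \<notin> W" if "k < t div 2" for k
    using that assms(4)[of "2 * k"] by (auto simp: g_def)
  have "inj_on g {..<t div 2}"
    by (rule inj_on_inverseI[where g = "\<lambda>k. k div 2"]) (simp add: g_def)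
  moreover have "inj_on f (g ` {..<t div 2})"
    using assms(1) by (rule inj_on_subset) (use g in auto)
  ultimately have "inj_on (f \<circ> g) {..<t div 2}" by (rule comp_inj_on)
  moreover have "(f \<circ> g) ` {..<t div 2} \<subseteq> F - W" using g assms(2) by auto
  ultimately show ?thesis
    using card_inj_on_le[of "f \<circ> g" "{..<t div 2}" "F - W"] assms(3) by simp
qed

lemma edges_complete_multipartite:
  assumes "disjoint_family_on V {1..m}" "i \<in> {1..m}" "j \<in> {1..m}" "x \<in> V i" "y \<in> V j"
  shows "{x, y} \<in> edges (complete_multipartite m V) \<longleftrightarrow> i \<noteq> j"
proof -
  have uniq: "a = b" if "a \<in> {1..m}" "b \<in> {1..m}" "z \<in> V a" "z \<in> V b" for a b z
    using assms(1) that unfolding disjoint_family_on_def by blast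
  show ?thesis
  proof
    assume "{x, y} \<in> edges (complete_multipartite m V)"
    then obtain x' y' i' j' where "{x, y} = {x', y'}" "i' \<in> {1..m}" "j' \<in> {1..m}" "i' \<noteq> j'"
      "x' \<in> V i'" "y' \<in> V j'" unfolding complete_multipartite_def by auto
    moreover from this(1) consider "x = x'" "y = y'" | "x = y'" "y = x'"
      by (auto simp: doubleton_eq_iff)
    ultimately show "i \<noteq> j" using uniq assms(2-5) by cases metis+
  next
    assume "i \<noteq> j"
    then show "{x, y} \<in> edges (complete_multipartite m V)"
      using assms(2-5) unfolding complete_multipartite_def snd_conv mem_Collect_eq by blast
  qed
qed

text \<open>
  The parts are the colour classes: the bounds needed by the greedy construction are those that
  disjoint edges of a path enforce.
\<close>

proposition path_free_complex_multipartite: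
  assumes "\<And>i. i \<in> {1..m} \<Longrightarrow> finite (V i)" "disjoint_family_on V {1..m}"
  shows "path_free_complex t (complete_multipartite m V) =
    {F. F \<subseteq> (\<Union>i\<in>{1..m}. V i) \<and> (card F < t \<or> (\<exists>i\<in>{1..m}. card (F - V i) < t div 2))}"
proof -
  let ?G = "complete_multipartite m V"
  have verts: "verts ?G = (\<Union>i\<in>{1..m}. V i)" by (simp add: complete_multipartite_def)
  have "(\<exists>H. is_subgraph H (induced_subgraph ?G F) \<and> graph_isomorphic (path_graph t) H) \<longleftrightarrow>
      t \<le> card F \<and> (\<forall>i\<in>{1..m}. t div 2 \<le> card (F - V i))" (is "?L \<longleftrightarrow> ?R")
    if F: "F \<subseteq> (\<Union>i\<in>{1..m}. V i)" for F
  proof -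
    have finF: "finite F" using F assms(1) by (auto intro: finite_subset)
    have "\<exists>i. x \<in> F \<longrightarrow> i \<in> {1..m} \<and> x \<in> V i" for x using F by blast
    then obtain col where col: "\<And>x. x \<in> F \<Longrightarrow> col x \<in> {1..m} \<and> x \<in> V (col x)" by metis
    have edge: "{x, y} \<in> edges ?G \<longleftrightarrow> col x \<noteq> col y" if "x \<in> F" "y \<in> F" for x y
      using edges_complete_multipartite[OF assms(2)] col that by blast
    have cls: "F - V i = {x \<in> F. col x \<noteq> i}" if "i \<in> {1..m}" for i
      using col assms(2) that unfolding disjoint_family_on_def by blast
    show ?thesis
    proof
      assume ?L
      then obtain f where f: "inj_on f {..<t}" "f ` {..<t} \<subseteq> F"
        and e: "\<forall>i. Suc i < t \<longrightarrow> {f i, f (Suc i)} \<in> edges ?G"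
        unfolding contains_path_induced_iff by blast
      have "t div 2 \<le> card (F - V i)" if "i \<in> {1..m}" for i
      proof (rule path_leaves_independent_set[OF f(1,2) finF])
        fix k assume k: "Suc k < t"
        then show "f k \<notin> V i \<or> f (Suc k) \<notin> V i"
          using edges_complete_multipartite[OF assms(2) that that] e by blast
      qed
      moreover have "t \<le> card F" using card_inj_on_le[OF f(1,2) finF] by simp
      ultimately show ?R by blast
    next
      assume ?R
      then have tF: "t \<le> card F" by blast
      have R: "t div 2 \<le> card {x \<in> F. col x \<noteq> j}" for j
      proof (cases "j \<in> {1..m}")
        case True
        then show ?thesis using \<open>?R\<close> cls by metis
      next
        case False
        then have "{x \<in> F. col x \<noteq> j} = F" using col by blast
        then show ?thesis using tF by simp
      qed
      \<comment> \<open>No vertex has the colour 0, so forbidding it for the first vertex is harmless.\<close>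
      have "{x \<in> F. col x \<noteq> 0} = F"
        using col by (metis (mono_tags, lifting) atLeastAtMost_iff not_one_le_zero
            Collect_cong Collect_mem_eq)
      then have "(t + 1) div 2 \<le> card {x \<in> F. col x \<noteq> 0}" using tF by simp
      then obtain xs where xs: "length xs = t" "distinct xs" "set xs \<subseteq> F"
        "successively (\<lambda>x y. col x \<noteq> col y) xs"
        using ex_properly_coloured_list[OF finF tF R, of 0] by blast
      have "inj_on (nth xs) {..<t}" using xs by (auto simp: inj_on_def nth_eq_iff_index_eq)
      moreover have "nth xs ` {..<t} \<subseteq> F" using xs by auto
      moreover have "{xs ! i, xs ! Suc i} \<in> edges ?G" if "Suc i < t" for i
        using xs edge[of "xs ! i" "xs ! Suc i"] that
        by (auto simp: successively_conv_nth subset_code(1))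
      ultimately show ?L
        unfolding contains_path_induced_iff by blast
    qed
  qed
  then show ?thesis
    unfolding path_free_complex_def verts by (intro Collect_cong conj_cong refl) (simp add: not_le)
qed


section \<open>Simplicial complexes: facets, links and deletions\<close>

lemma finite_complex: "simplicial_complex \<Delta> \<Longrightarrow> finite \<Delta>"
  unfolding simplicial_complex_def by (rule finite_subset[of _ "Pow (\<Union>\<Delta>)"]) auto

lemma finite_face: "simplicial_complex \<Delta> \<Longrightarrow> F \<in> \<Delta> \<Longrightarrow> finite F"
  unfolding simplicial_complex_def using finite_subset[OF Union_upper] by blast

lemma face_subset: "simplicial_complex \<Delta> \<Longrightarrow> F \<in> \<Delta> \<Longrightarrow> F' \<subseteq> F \<Longrightarrow> F' \<in> \<Delta>"
  unfolding simplicial_complex_def by blast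

lemma subcomplexI:
  "simplicial_complex \<Delta> \<Longrightarrow> \<Gamma> \<subseteq> \<Delta> \<Longrightarrow> (\<And>F F'. F \<in> \<Gamma> \<Longrightarrow> F' \<subseteq> F \<Longrightarrow> F' \<in> \<Gamma>) \<Longrightarrow> simplicial_complex \<Gamma>"
  unfolding simplicial_complex_def using finite_subset[OF Union_mono, of \<Gamma> \<Delta>] by blast

lemma simplicial_complex_link: "simplicial_complex \<Delta> \<Longrightarrow> simplicial_complex (link \<Delta> \<sigma>)"
  by (rule subcomplexI) (auto simp: link_def elim: face_subset intro: face_subset[of _ "\<sigma> \<union> _"])

lemma simplicial_complex_vertex_deletion:
  "simplicial_complex \<Delta> \<Longrightarrow> simplicial_complex (vertex_deletion \<Delta> v)"
  by (rule subcomplexI) (auto simp: vertex_deletion_def elim: face_subset)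

lemma simplicial_complex_face_deletion:
  "simplicial_complex \<Delta> \<Longrightarrow> simplicial_complex (face_deletion \<Delta> F)"
  by (rule subcomplexI) (auto simp: face_deletion_def elim: face_subset)

lemma link_empty [simp]: "link \<Delta> {} = \<Delta>"
  by (auto simp: link_def)

lemma facet_above:
  assumes "simplicial_complex \<Delta>" "F \<in> \<Delta>"
  obtains K where "K \<in> facets \<Delta>" "F \<subseteq> K"
proof -
  obtain K where "K \<in> \<Delta>" "F \<subseteq> K" "\<forall>F'\<in>\<Delta>. K \<le> F' \<longrightarrow> K = F'"
    using finite_has_maximal2[OF finite_complex[OF assms(1)] assms(2)] by auto
  then show ?thesis using that[of K] by (auto simp: facets_def)
qed

lemma is_simplex_Pow: "finite W \<Longrightarrow> is_simplex (Pow W)"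
proof -
  assume "finite W"
  moreover have "facets (Pow W) = {W}" by (auto simp: facets_def)
  ultimately show ?thesis unfolding is_simplex_def simplicial_complex_def by auto
qed

lemma is_simplex_cases:
  assumes "is_simplex \<Delta>"
  obtains "\<Delta> = {}" | W where "finite W" "\<Delta> = Pow W"
proof (cases "\<Delta> = {}")
  case False
  have sc: "simplicial_complex \<Delta>" using assms by (simp add: is_simplex_def)
  obtain W where W: "W \<in> facets \<Delta>" "\<And>K. K \<in> facets \<Delta> \<Longrightarrow> K = W"
    using assms False unfolding is_simplex_def by blast
  have "W \<in> \<Delta>" using W(1) by (simp add: facets_def)
  have "F \<subseteq> W" if F: "F \<in> \<Delta>" for F using facet_above[OF sc F] W(2) by metis
  then have "\<Delta> = Pow W" using face_subset[OF sc \<open>W \<in> \<Delta>\<close>] by blast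
  then show ?thesis by (rule that(2)[OF finite_face[OF sc \<open>W \<in> \<Delta>\<close>]])
qed (use that(1) in simp)


section \<open>Complexes cut out by two cardinality bounds\<close>

text \<open>
  The faces containing few elements altogether, or few elements of \<open>B\<close>. For \<open>h = 0\<close> this is a
  skeleton of a simplex. Elements of \<open>B\<close> outside \<open>U\<close> are tolerated so that \<open>B\<close> can stay fixed when a
  vertex is removed from \<open>U\<close>.
\<close>

definition bounded_complex :: "'a set \<Rightarrow> 'a set \<Rightarrow> nat \<Rightarrow> nat \<Rightarrow> 'a set set" where
  "bounded_complex U B r h = {F. F \<subseteq> U \<and> (card F \<le> r \<or> card (F \<inter> B) < h)}"

lemma simplicial_complex_bounded_complex:
  assumes "finite U"
  shows "simplicial_complex (bounded_complex U B r h)"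
proof -
  have "F' \<in> bounded_complex U B r h" if F: "F \<in> bounded_complex U B r h" "F' \<subseteq> F" for F F'
  proof -
    have "F \<subseteq> U" using F(1) by (simp add: bounded_complex_def)
    then have "finite F" using assms finite_subset by blast
    then have "card F' \<le> card F" "card (F' \<inter> B) \<le> card (F \<inter> B)"
      using F(2) by (auto intro!: card_mono)
    then show ?thesis using F by (auto simp: bounded_complex_def)
  qed
  moreover have "\<Union>(bounded_complex U B r h) \<subseteq> U" by (auto simp: bounded_complex_def)
  ultimately show ?thesis
    using assms finite_subset unfolding simplicial_complex_def by blast
qed

text \<open>A criterion for shedding vertices that only looks at enlarging a face by one vertex.\<close>

lemma facets_vertex_deletion_subset:
  assumes "simplicial_complex \<Delta>"
    "\<And>F. insert v F \<in> \<Delta> \<Longrightarrow> v \<notin> F \<Longrightarrow> \<exists>w. w \<notin> F \<and> w \<noteq> v \<and> insert w F \<in> \<Delta>"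
  shows "facets (vertex_deletion \<Delta> v) \<subseteq> facets \<Delta>"
proof
  fix F assume F: "F \<in> facets (vertex_deletion \<Delta> v)"
  then have "F \<in> \<Delta>" "v \<notin> F" by (auto simp: facets_def vertex_deletion_def)
  have max: "F' = F" if "F' \<in> \<Delta>" "v \<notin> F'" "F \<subseteq> F'" for F'
    using F that by (auto simp: facets_def vertex_deletion_def)
  have "F' = F" if F': "F' \<in> \<Delta>" "F \<subseteq> F'" for F'
  proof (rule max[OF F'(1) _ F'(2)], rule notI)
    assume "v \<in> F'"
    then have "insert v F \<in> \<Delta>" using face_subset[OF assms(1) F'(1)] F'(2) by auto
    then obtain w where "w \<notin> F" "w \<noteq> v" "insert w F \<in> \<Delta>" using assms(2) \<open>v \<notin> F\<close> by blast
    then show False using max[of "insert w F"] \<open>v \<notin> F\<close> by blast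
  qed
  then show "F \<in> facets \<Delta>" using \<open>F \<in> \<Delta>\<close> by (auto simp: facets_def)
qed

text \<open>
  Any vertex of \<open>B\<close> can be shed (any vertex at all if \<open>h = 0\<close>): links and deletions are again of the
  same form. A face that can be enlarged by \<open>v\<close> can be enlarged by another vertex as well: unless the
  complex is a simplex, a set with at most \<open>r\<close> elements misses an element of \<open>U\<close>, and a set with
  fewer than \<open>h\<close> elements of \<open>B\<close> misses an element of \<open>U \<inter> B\<close>, which can take the place of \<open>v\<close>.
\<close>

proposition vertex_decomposable_bounded_complex:
  assumes "finite U"
  shows "vertex_decomposable (bounded_complex U B r h)"
  using assms
proof (induction "card U" arbitrary: U r h rule: less_induct)
  case less
  let ?D = "bounded_complex U B r h"
  consider "card U \<le> r \<or> card (U \<inter> B) < h" | "r = 0" "h \<le> 1"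
    | "r < card U" "h \<le> card (U \<inter> B)" "r > 0 \<or> h > 1" by linarith
  then show ?case
  proof cases
    case 1
    have "F \<in> ?D" if "F \<subseteq> U" for F
    proof -
      have "card F \<le> card U" "card (F \<inter> B) \<le> card (U \<inter> B)"
        using that less.prems by (auto intro!: card_mono)
      then show ?thesis using 1 that by (auto simp: bounded_complex_def)
    qed
    then have "?D = Pow U" by (auto simp: bounded_complex_def)
    then show ?thesis
      by (metis vertex_decomposable.simplex is_simplex_Pow less.prems)
  next
    case 2
    have "F \<in> ?D \<longleftrightarrow> F \<subseteq> (if h = 0 then {} else U - B)" for F
    proof (cases "F \<subseteq> U")
      case True
      then have "finite F" using less.prems finite_subset by blast
      then have "card F = 0 \<longleftrightarrow> F = {}" "card (F \<inter> B) = 0 \<longleftrightarrow> F \<inter> B = {}" by simp_all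
      then show ?thesis using 2 True by (cases "h = 0") (auto simp: bounded_complex_def less_Suc_eq)
    qed (auto simp: bounded_complex_def)
    then have "?D = Pow (if h = 0 then {} else U - B)" by auto
    then show ?thesis
      using is_simplex_Pow[of "if h = 0 then {} else U - B"] less.prems
      by (auto intro: vertex_decomposable.simplex)
  next
    case 3
    have "\<exists>v \<in> U. h = 0 \<or> v \<in> B"
    proof (cases "h = 0")
      case True
      moreover have "U \<noteq> {}" using 3(1) by auto
      ultimately show ?thesis by blast
    next
      case False
      then have "U \<inter> B \<noteq> {}" using 3(2) by force
      then show ?thesis by blast
    qed
    then obtain v where v: "v \<in> U" "h = 0 \<or> v \<in> B" by blast
    let ?U = "U - {v}"
    have smaller: "card ?U < card U" using v less.prems by (intro psubset_card_mono) auto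
    have sc: "simplicial_complex ?D"
      using less.prems by (rule simplicial_complex_bounded_complex)
    have vD: "{v} \<in> ?D" using v 3(3) by (auto simp: bounded_complex_def)
    have del: "vertex_deletion ?D v = bounded_complex ?U B r h"
      by (auto simp: vertex_deletion_def bounded_complex_def)
    have insert_iff: "insert v F \<in> ?D \<longleftrightarrow> F \<in> bounded_complex ?U B (r - 1) (h - 1)"
      if F: "F \<subseteq> U" "v \<notin> F" for F
    proof -
      have fin: "finite F" using F less.prems finite_subset by blast
      show ?thesis
        using v F fin 3(3)
        by (cases "v \<in> B"; cases "r = 0") (auto simp: bounded_complex_def card_eq_0_iff)
    qed
    have lk: "link ?D {v} = bounded_complex ?U B (r - 1) (h - 1)"
    proof (rule Set.set_eqI)
      fix F
      have "F \<in> link ?D {v} \<longleftrightarrow> F \<subseteq> U \<and> v \<notin> F \<and> insert v F \<in> ?D"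
        using face_subset[OF sc, of "insert v F" F] by (auto simp: link_def bounded_complex_def)
      also have "\<dots> \<longleftrightarrow> F \<in> bounded_complex ?U B (r - 1) (h - 1)"
        using insert_iff[of F] by (auto simp: bounded_complex_def)
      finally show "F \<in> link ?D {v} \<longleftrightarrow> F \<in> bounded_complex ?U B (r - 1) (h - 1)" .
    qed
    have "facets (vertex_deletion ?D v) \<subseteq> facets ?D"
    proof (rule facets_vertex_deletion_subset[OF sc])
      fix F assume F: "insert v F \<in> ?D" "v \<notin> F"
      then have sub: "insert v F \<subseteq> U" by (auto simp: bounded_complex_def)
      have fin: "finite (insert v F)" by (rule finite_subset[OF sub less.prems])
      consider "card (insert v F) \<le> r" | "card (insert v F \<inter> B) < h"
        using F(1) by (auto simp: bounded_complex_def)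
      then show "\<exists>w. w \<notin> F \<and> w \<noteq> v \<and> insert w F \<in> ?D"
      proof cases
        case 1
        then have "\<not> U \<subseteq> insert v F" using 3(1) card_mono[OF fin, of U] by linarith
        then obtain w where "w \<in> U" "w \<notin> insert v F" by blast
        then show ?thesis
          using 1 F(2) fin sub by (intro exI[of _ w]) (auto simp: bounded_complex_def)
      next
        case 2
        then have "\<not> U \<inter> B \<subseteq> insert v F \<inter> B"
          using 3(2) card_mono[of "insert v F \<inter> B" "U \<inter> B"] fin by fastforce
        then obtain w where w: "w \<in> U" "w \<in> B" "w \<notin> insert v F" by blast
        moreover have "v \<in> B" using 2 v by auto
        ultimately have "card (insert w F \<inter> B) = card (insert v F \<inter> B)"
          using F(2) fin by simp
        then show ?thesis
          using 2 w sub by (intro exI[of _ w]) (auto simp: bounded_complex_def)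
      qed
    qed
    then show ?thesis
      using vertex_decomposable.shedding[OF sc vD] less.hyps[OF smaller] less.prems del lk by simp
  qed
qed


section \<open>Shellability and strong connectedness\<close>

lemma vertex_decomposable_imp_shellable: "vertex_decomposable \<Delta> \<Longrightarrow> shellable \<Delta>"
proof (induction rule: vertex_decomposable.induct)
  case (simplex \<Delta>)
  then show ?case by (rule shellable.simplex)
next
  case (shedding \<Delta> v)
  have "vertex_deletion \<Delta> v = face_deletion \<Delta> {v}"
    by (auto simp: vertex_deletion_def face_deletion_def)
  then show ?case using shedding shellable.shedding by metis
qed

text \<open>
  Facets of the pure skeleton of dimension \<open>p - 1\<close> that are equal or share a ridge. The pure skeleton
  is strongly connected if the reflexive transitive closure relates any two of them.
\<close>

definition ridge_adjacent :: "nat \<Rightarrow> 'a set set \<Rightarrow> ('a set \<times> 'a set) set" where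
  "ridge_adjacent p \<Delta> =
     {(F, F'). F \<in> \<Delta> \<and> F' \<in> \<Delta> \<and> card F = p \<and> card F' = p \<and> p \<le> card (F \<inter> F') + 1}"

lemma sym_ridge_adjacent: "sym (ridge_adjacent p \<Delta>)"
  by (auto simp: sym_def ridge_adjacent_def Int_commute)

lemma ridge_adjacent_mono: "\<Gamma> \<subseteq> \<Delta> \<Longrightarrow> ridge_adjacent p \<Gamma> \<subseteq> ridge_adjacent p \<Delta>"
  by (auto simp: ridge_adjacent_def)

lemma ridge_adjacent_swap:
  assumes "finite F" "x \<in> F" "y \<notin> F" "F \<in> \<Delta>" "insert y (F - {x}) \<in> \<Delta>"
  shows "(F, insert y (F - {x})) \<in> ridge_adjacent (card F) \<Delta>"
proof -
  have "F \<inter> insert y (F - {x}) = F - {x}" using assms by auto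
  moreover have "card (insert y (F - {x})) = card F" "card F = card (F - {x}) + 1"
    using assms(1-3) card_Suc_Diff1[of F x] by simp_all
  ultimately show ?thesis
    using assms(4,5) unfolding ridge_adjacent_def by simp
qed

lemma strongly_connected_Pow:
  assumes "finite W" "G \<subseteq> W" "G' \<subseteq> W" "card G = card G'"
  shows "(G, G') \<in> (ridge_adjacent (card G) (Pow W))\<^sup>*"
  using assms(2,4)
proof (induction "card (G - G')" arbitrary: G)
  case 0
  have fin: "finite G" "finite G'" using 0 assms(1,3) finite_subset by blast+
  then have "G \<subseteq> G'" using 0 by simp
  then have "G = G'" using card_subset_eq[OF fin(2)] 0 by simp
  then show ?case by simp
next
  case (Suc k)
  have fin: "finite G" "finite G'" using Suc.prems assms(1,3) finite_subset by blast+
  have "G - G' \<noteq> {}" using Suc.hyps(2) by force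
  then obtain x where x: "x \<in> G" "x \<notin> G'" by blast
  have "\<not> G' \<subseteq> G" using card_subset_eq[OF fin(1), of G'] Suc.prems x by auto
  then obtain y where y: "y \<in> G'" "y \<notin> G" by blast
  let ?H = "insert y (G - {x})"
  have HW: "?H \<subseteq> W" using Suc.prems(1) y assms(3) by auto
  have card: "card ?H = card G"
    using x y fin card_Suc_Diff1[of G x] by simp
  have "?H - G' = G - G' - {x}" using y by auto
  then have "card (?H - G') = k" using Suc.hyps(2) x by simp
  then have "(?H, G') \<in> (ridge_adjacent (card G) (Pow W))\<^sup>*"
    using Suc.hyps(1)[of ?H] HW Suc.prems(2) card by simp
  moreover have "(G, ?H) \<in> ridge_adjacent (card G) (Pow W)"
    using ridge_adjacent_swap[OF fin(1) x(1) y(2), of "Pow W"] HW Suc.prems(1) by auto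
  ultimately show ?case by (rule converse_rtrancl_into_rtrancl[rotated])
qed

text \<open>
  The faces containing the shedding face form a copy of the link, and the others form the face
  deletion, so both families are connected by induction. They are joined by an adjacency: if \<open>v\<close> lies
  in the shedding face \<open>F\<close> and \<open>F \<subseteq> G\<close>, then \<open>G - {v}\<close> is not a facet, hence not a facet of the face
  deletion either, so that it can be enlarged there by another vertex than \<open>v\<close>.
\<close>

proposition shellable_strongly_connected:
  assumes "shellable \<Delta>" "G \<in> \<Delta>" "G' \<in> \<Delta>" "card G = p" "card G' = p"
  shows "(G, G') \<in> (ridge_adjacent p \<Delta>)\<^sup>*"
  using assms
proof (induction arbitrary: G G' p rule: shellable.induct)
  case (simplex \<Delta>)
  then show ?case
    by (cases rule: is_simplex_cases) (auto intro: strongly_connected_Pow)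
next
  case (shedding \<Delta> F)
  note sc = \<open>simplicial_complex \<Delta>\<close>
  let ?R = "(ridge_adjacent p \<Delta>)\<^sup>*"
  show ?case
  proof (cases "F = {}")
    case True
    then show ?thesis using shedding.IH(1) shedding.prems by simp
  next
    case False
    then obtain v where v: "v \<in> F" by blast
    have "face_deletion \<Delta> F \<subseteq> \<Delta>" by (auto simp: face_deletion_def)
    then have outside: "(H, H') \<in> ?R"
      if "H \<in> face_deletion \<Delta> F" "H' \<in> face_deletion \<Delta> F" "card H = p" "card H' = p" for H H'
      using shedding.IH(2)[OF that] rtrancl_mono[OF ridge_adjacent_mono] by blast
    have inside: "(H, H') \<in> ?R"
      if H: "H \<in> \<Delta>" "H' \<in> \<Delta>" "card H = p" "card H' = p" "F \<subseteq> H" "F \<subseteq> H'" for H H'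
    proof -
      have fin: "finite H" "finite H'" "finite F"
        using H(1,2) shedding.hyps(2) finite_face[OF sc] by blast+
      have lift: "(K \<union> F, K' \<union> F) \<in> ridge_adjacent p \<Delta>"
        if K: "(K, K') \<in> ridge_adjacent (p - card F) (link \<Delta> F)" for K K'
      proof -
        have sub: "K \<union> F \<in> \<Delta>" "K' \<union> F \<in> \<Delta>" "K \<inter> F = {}" "K' \<inter> F = {}"
          using K by (auto simp: ridge_adjacent_def link_def Un_commute)
        then have "finite (K \<union> F)" "finite (K' \<union> F)" using finite_face[OF sc] by blast+
        moreover have "card F \<le> p" using card_mono[OF fin(1) H(5)] H(3) by simp
        moreover have "(K \<union> F) \<inter> (K' \<union> F) = (K \<inter> K') \<union> F" by auto
        moreover have "(K \<inter> K') \<inter> F = {}" using sub by auto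
        ultimately show ?thesis
          using K sub by (auto simp: ridge_adjacent_def card_Un_disjoint)
      qed
      have "H - F \<in> link \<Delta> F" "H' - F \<in> link \<Delta> F"
        using H face_subset[OF sc] by (auto simp: link_def Un_absorb1)
      moreover have "card (H - F) = p - card F" "card (H' - F) = p - card F"
        using H fin by (simp_all add: card_Diff_subset)
      ultimately have "(H - F, H' - F) \<in> (ridge_adjacent (p - card F) (link \<Delta> F))\<^sup>*"
        using shedding.IH(1) by blast
      then have "((H - F) \<union> F, (H' - F) \<union> F) \<in> ?R"
        by (induction rule: rtrancl_induct) (auto intro: rtrancl_into_rtrancl lift)
      then show ?thesis using H(5,6) by (simp add: Un_absorb2)
    qed
    have cross: "(H, H') \<in> ?R"
      if H: "H \<in> \<Delta>" "card H = p" "F \<subseteq> H" and H': "H' \<in> face_deletion \<Delta> F" "card H' = p" for H H'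
    proof -
      have "H - {v} \<in> face_deletion \<Delta> F"
        using face_subset[OF sc H(1)] v by (auto simp: face_deletion_def)
      then obtain K where K: "K \<in> facets (face_deletion \<Delta> F)" "H - {v} \<subseteq> K"
        using facet_above[OF simplicial_complex_face_deletion[OF sc]] by metis
      have "v \<in> H" using v H(3) by blast
      have "K \<in> facets \<Delta>" using K(1) shedding.hyps by blast
      then have "K \<noteq> H - {v}" using H(1) \<open>v \<in> H\<close> by (auto simp: facets_def)
      then obtain x where x: "x \<in> K" "x \<notin> H - {v}" using K(2) by blast
      have KD: "K \<in> face_deletion \<Delta> F" using K(1) by (simp add: facets_def)
      have "v \<notin> K" using KD K(2) H(3) by (auto simp: face_deletion_def)
      then have "x \<notin> H" using x by blast
      let ?H = "insert x (H - {v})"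
      have "?H \<in> face_deletion \<Delta> F"
        using face_subset[OF simplicial_complex_face_deletion[OF sc] KD] K(2) x by auto
      moreover from this have "(H, ?H) \<in> ridge_adjacent p \<Delta>"
        using ridge_adjacent_swap[OF finite_face[OF sc H(1)] \<open>v \<in> H\<close> \<open>x \<notin> H\<close>, of \<Delta>] H
        by (auto simp: face_deletion_def)
      ultimately show ?thesis
        using outside[of ?H H'] H' by (auto simp: ridge_adjacent_def intro: converse_rtrancl_into_rtrancl)
    qed
    have "sym ?R" using sym_ridge_adjacent by (rule sym_rtrancl)
    moreover have "H \<in> face_deletion \<Delta> F" if "H \<in> \<Delta>" "\<not> F \<subseteq> H" for H
      using that by (simp add: face_deletion_def)
    ultimately show ?thesis
      using inside outside cross shedding.prems unfolding sym_def by metis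
  qed
qed


section \<open>The boundary operator on all finite subsets of the ground set\<close>

text \<open>
  The boundary operator of a complex is the restriction of a single operator that depends on a finite
  ground set \<open>U\<close> only. This makes it possible to move chains between a complex, its links and its
  deletions without changing the operator.
\<close>

definition incidence :: "'a::linorder \<Rightarrow> 'a set \<Rightarrow> 'k::field" where
  "incidence v F = (- 1) ^ card {u \<in> F. u < v}"

definition boundary :: "'a::linorder set \<Rightarrow> ('a set \<Rightarrow> 'k::field) \<Rightarrow> 'a set \<Rightarrow> 'k" where
  "boundary U c F = (\<Sum>v\<in>U - F. incidence v F * c (insert v F))"

definition cone :: "'a::linorder \<Rightarrow> ('a set \<Rightarrow> 'k::field) \<Rightarrow> 'a set \<Rightarrow> 'k" where
  "cone v c F = (if v \<in> F then incidence v F * c (F - {v}) else 0)"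

lemma incidence_insert_self [simp]: "incidence v (insert v F) = (incidence v F :: 'k::field)"
  unfolding incidence_def by (intro arg_cong[of _ _ "\<lambda>S. (- 1) ^ card S"]) auto

lemma incidence_empty [simp]: "incidence v {} = 1"
  by (simp add: incidence_def)

lemma incidence_square [simp]: "incidence v F * incidence v F = (1 :: 'k::field)"
  by (simp add: incidence_def flip: power_mult_distrib)

lemma incidence_nonzero [simp]: "incidence v F \<noteq> (0 :: 'k::field)"
  by (simp add: incidence_def)

lemma incidence_insert:
  assumes "finite F" "w \<notin> F"
  shows "incidence v (insert w F) = (if w < v then - incidence v F else (incidence v F :: 'k::field))"
proof (cases "w < v")
  case True
  then have "{u \<in> insert w F. u < v} = insert w {u \<in> F. u < v}" by auto
  then show ?thesis using assms True by (simp add: incidence_def)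
next
  case False
  then have "{u \<in> insert w F. u < v} = {u \<in> F. u < v}" by auto
  then show ?thesis using False by (simp add: incidence_def)
qed

lemma incidence_swap:
  assumes "finite F" "v \<notin> F" "w \<notin> F" "v \<noteq> w"
  shows "incidence v F * incidence w (insert v F) =
    - (incidence w F * incidence v (insert w F) :: 'k::field)"
  using assms by (auto simp: incidence_insert)

lemma boundary_map_eq_boundary:
  fixes c :: "'a::linorder set \<Rightarrow> 'k::field"
  assumes "finite \<Delta>" "finite U" "\<Union>\<Delta> \<subseteq> U" "c \<in> chains \<Delta> i"
  shows "boundary_map \<Delta> c = boundary U c"
proof
  fix G
  have term_eq: "(\<Sum>F\<in>\<Delta>. if v \<in> F \<and> G = F - {v} then (- 1) ^ card {u \<in> F. u < v} * c F else 0) =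
      (if v \<in> G then 0 else incidence v G * c (insert v G))" (is "sum ?f \<Delta> = _") for v
  proof (cases "v \<in> G")
    case True
    then show ?thesis by (auto intro!: sum.neutral)
  next
    case False
    have "?f F = (if F = insert v G then incidence v (insert v G) * c (insert v G) else 0)" for F
      using False by (auto simp: incidence_def)
    then have "sum ?f \<Delta> =
        (\<Sum>F\<in>\<Delta>. if F = insert v G then incidence v (insert v G) * c (insert v G) else 0)"
      by simp
    also have "\<dots> = incidence v G * c (insert v G)"
      using assms(1,4) by (auto simp: sum.delta chains_def)
    finally show ?thesis using False by simp
  qed
  have "boundary_map \<Delta> c G = (\<Sum>F\<in>\<Delta>. \<Sum>v\<in>U.
      if v \<in> F \<and> G = F - {v} then (- 1) ^ card {u \<in> F. u < v} * c F else 0)"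
    unfolding boundary_map_def
  proof (rule sum.cong[OF refl])
    fix F assume "F \<in> \<Delta>"
    then have "F \<subseteq> U" using assms(3) by blast
    then show "(\<Sum>v\<in>F. if G = F - {v} then (- 1) ^ card {u \<in> F. u < v} * c F else 0) =
        (\<Sum>v\<in>U. if v \<in> F \<and> G = F - {v} then (- 1) ^ card {u \<in> F. u < v} * c F else 0)"
      using assms(2) by (intro sum.mono_neutral_cong_left) auto
  qed
  also have "\<dots> = (\<Sum>v\<in>U. if v \<in> G then 0 else incidence v G * c (insert v G))"
    by (subst sum.swap) (simp only: term_eq)
  also have "\<dots> = boundary U c G"
    unfolding boundary_def using assms(2) by (intro sum.mono_neutral_cong_right) auto
  finally show "boundary_map \<Delta> c G = boundary U c G" .
qed

lemma boundary_zero [simp]: "boundary U (\<lambda>_. 0) = (\<lambda>_. 0)"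
  by (auto simp: boundary_def)

lemma boundary_add: "boundary U (\<lambda>F. c F + d F) = (\<lambda>F. boundary U c F + boundary U d F)"
  by (auto simp: boundary_def algebra_simps sum.distrib)

lemma boundary_minus: "boundary U (\<lambda>F. - c F) = (\<lambda>F. - boundary U c F)"
  by (auto simp: boundary_def sum_negf)

lemma boundary_diff: "boundary U (\<lambda>F. c F - d F) = (\<lambda>F. boundary U c F - boundary U d F)"
  by (auto simp: boundary_def algebra_simps sum_subtractf)

text \<open>
  The terms cancel in pairs. Exchanging the order of summation would only show that the sum is its own
  negative, which is void in characteristic 2.
\<close>

lemma sum_antisymmetric:
  fixes f :: "'a \<Rightarrow> 'a \<Rightarrow> 'k::ab_group_add"
  assumes "finite A" "\<And>v w. v \<in> A \<Longrightarrow> w \<in> A \<Longrightarrow> v \<noteq> w \<Longrightarrow> f v w = - f w v"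
  shows "(\<Sum>v\<in>A. \<Sum>w\<in>A - {v}. f v w) = 0"
  using assms
proof (induction A)
  case empty
  show ?case by simp
next
  case (insert a A)
  have row: "(\<Sum>w\<in>insert a A - {v}. f v w) = f v a + (\<Sum>w\<in>A - {v}. f v w)" if "v \<in> A" for v
  proof -
    have "insert a A - {v} = insert a (A - {v})" using that insert.hyps by auto
    then show ?thesis using insert.hyps by simp
  qed
  have "(\<Sum>v\<in>insert a A. \<Sum>w\<in>insert a A - {v}. f v w) =
      (\<Sum>w\<in>A. f a w) + (\<Sum>v\<in>A. f v a + (\<Sum>w\<in>A - {v}. f v w))"
    using insert.hyps row by simp
  also have "\<dots> = (\<Sum>w\<in>A. f a w + f w a) + (\<Sum>v\<in>A. \<Sum>w\<in>A - {v}. f v w)"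
    by (simp add: sum.distrib add.assoc)
  also have "(\<Sum>w\<in>A. f a w + f w a) = 0"
  proof (rule sum.neutral, rule ballI)
    fix w assume "w \<in> A"
    then have "a \<noteq> w" using insert.hyps(2) by blast
    then show "f a w + f w a = 0" using insert.prems[of a w] \<open>w \<in> A\<close> by simp
  qed
  also have "(\<Sum>v\<in>A. \<Sum>w\<in>A - {v}. f v w) = 0"
    by (rule insert.IH, rule insert.prems) simp_all
  finally show ?case by simp
qed

lemma boundary_boundary:
  fixes c :: "'a::linorder set \<Rightarrow> 'k::field"
  assumes "finite U" "\<And>F. infinite F \<Longrightarrow> c F = 0"
  shows "boundary U (boundary U c) = (\<lambda>_. 0)"
proof
  fix F
  show "boundary U (boundary U c) F = 0"
  proof (cases "finite F")
    case True
    define f where "f v w =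
      incidence v F * incidence w (insert v F) * c (insert w (insert v F))" for v w
    have "boundary U (boundary U c) F = (\<Sum>v\<in>U - F. \<Sum>w\<in>U - insert v F. f v w)"
      by (simp add: boundary_def f_def sum_distrib_left mult.assoc)
    also have "\<dots> = (\<Sum>v\<in>U - F. \<Sum>w\<in>(U - F) - {v}. f v w)"
      by (intro sum.cong refl) auto
    also have "\<dots> = 0"
    proof (rule sum_antisymmetric)
      fix v w assume "v \<in> U - F" "w \<in> U - F" "v \<noteq> w"
      then show "f v w = - f w v"
        using True by (simp add: f_def incidence_swap[of F v w] insert_commute)
    qed (use assms(1) in simp)
    finally show ?thesis .
  next
    case False
    then show ?thesis using assms(2) by (simp add: boundary_def)
  qed
qed

text \<open>Coning with \<open>v\<close> contracts the simplex on \<open>U\<close>.\<close>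

lemma boundary_cone:
  fixes c :: "'a::linorder set \<Rightarrow> 'k::field"
  assumes "finite U" "v \<in> U" "\<And>F. infinite F \<Longrightarrow> c F = 0"
  shows "boundary U (cone v c) F + cone v (boundary U c) F = c F"
proof (cases "finite F")
  case fin: True
  show ?thesis
  proof (cases "v \<in> F")
    case False
    have "boundary U (cone v c) F =
        (\<Sum>w\<in>U - F. if w = v then incidence v F * (incidence v F * c F) else 0)"
      unfolding boundary_def using False by (intro sum.cong refl) (auto simp: cone_def)
    also have "\<dots> = c F"
      using False assms(1,2) by (simp add: mult.assoc[symmetric])
    finally show ?thesis using False by (simp add: cone_def)
  next
    case True
    define E where "E = F - {v}"
    have F: "F = insert v E" "v \<notin> E" "finite E" using True fin by (auto simp: E_def)
    have UE: "U - E = insert v (U - F)" "v \<notin> U - F" "finite (U - F)" using F assms(1,2) by auto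
    have "boundary U c E = incidence v E * c F + (\<Sum>w\<in>U - F. incidence w E * c (insert w E))"
      unfolding boundary_def UE(1) sum.insert[OF UE(3,2)] F(1)[symmetric] by (rule refl)
    moreover have "incidence v F = (incidence v E :: 'k)" using F(1) by simp
    ultimately have "cone v (boundary U c) F =
        incidence v E * (incidence v E * c F + (\<Sum>w\<in>U - F. incidence w E * c (insert w E)))"
      using True by (simp add: cone_def flip: E_def)
    also have "\<dots> = c F + (\<Sum>w\<in>U - F. incidence v E * incidence w E * c (insert w E))"
      by (simp add: distrib_left sum_distrib_left mult.assoc[symmetric])
    finally have 1: "cone v (boundary U c) F =
        c F + (\<Sum>w\<in>U - F. incidence v E * incidence w E * c (insert w E))" .
    have "boundary U (cone v c) F =
        (\<Sum>w\<in>U - F. - (incidence v E * incidence w E * c (insert w E)))"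
      unfolding boundary_def
    proof (intro sum.cong refl)
      fix w assume "w \<in> U - F"
      then have w: "w \<noteq> v" "w \<notin> E" using F by auto
      have "insert w F - {v} = insert w E" using w F by auto
      moreover have "incidence v (insert w F) = (incidence v (insert w E) :: 'k)"
        using F by (simp add: insert_commute[of w])
      ultimately have "incidence w F * cone v c (insert w F) =
          incidence w F * incidence v (insert w E) * c (insert w E)"
        using True by (simp add: cone_def)
      moreover have "incidence w F * incidence v (insert w E) = - (incidence v E * incidence w E :: 'k)"
        using w F(2,3) unfolding F(1) by (auto simp: incidence_insert)
      ultimately show "incidence w F * cone v c (insert w F) =
          - (incidence v E * incidence w E * c (insert w E))"
        by simp
    qed
    then show ?thesis using 1 by (simp add: sum_negf)
  qed
next
  case False
  then have "boundary U c (F - {v}) = 0" "cone v c (insert w F) = 0" for w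
    using assms(3) by (simp_all add: boundary_def cone_def)
  then show ?thesis using False assms(3) by (simp add: boundary_def cone_def[of v "boundary U c"])
qed


section \<open>Vanishing of homology\<close>

text \<open>
  Vanishing of the reduced homology in degree \<open>i\<close>, for complexes on the ground set \<open>U\<close>.
\<close>

definition exact_at :: "'k::field itself \<Rightarrow> 'a::linorder set \<Rightarrow> 'a set set \<Rightarrow> int \<Rightarrow> bool" where
  "exact_at K U \<Delta> i \<longleftrightarrow> (\<forall>c :: 'a set \<Rightarrow> 'k. c \<in> chains \<Delta> i \<longrightarrow> boundary U c = (\<lambda>_. 0) \<longrightarrow>
     (\<exists>b \<in> chains \<Delta> (i + 1). boundary U b = c))"

lemma chains_zero [simp]: "(\<lambda>_. 0) \<in> chains \<Delta> i"
  by (simp add: chains_def)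

lemma chains_add: "c \<in> chains \<Delta> i \<Longrightarrow> d \<in> chains \<Delta> i \<Longrightarrow> (\<lambda>F. c F + d F) \<in> chains \<Delta> i"
  unfolding chains_def by simp (metis add_0)

lemma chains_minus: "c \<in> chains \<Delta> i \<Longrightarrow> (\<lambda>F. - c F) \<in> chains \<Delta> i"
  by (auto simp: chains_def)

lemma chains_mono: "\<Gamma> \<subseteq> \<Delta> \<Longrightarrow> chains \<Gamma> i \<subseteq> chains \<Delta> i"
  by (auto simp: chains_def)

lemma chains_infinite:
  "simplicial_complex \<Delta> \<Longrightarrow> c \<in> chains \<Delta> i \<Longrightarrow> infinite F \<Longrightarrow> c F = 0"
  using finite_face by (fastforce simp: chains_def)

lemma boundary_in_chains:
  fixes c :: "'a::linorder set \<Rightarrow> 'k::field"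
  assumes "simplicial_complex \<Delta>" "c \<in> chains \<Delta> i"
  shows "boundary U c \<in> chains \<Delta> (i - 1)"
  unfolding chains_def
proof (intro CollectI allI impI)
  fix F assume "boundary U c F \<noteq> 0"
  then obtain v where "v \<in> U - F" "incidence v F * c (insert v F) \<noteq> 0"
    unfolding boundary_def by (meson sum.not_neutral_contains_not_neutral)
  then have v: "v \<notin> F" "insert v F \<in> \<Delta>" "face_dim (insert v F) = i"
    using assms(2) by (auto simp: chains_def)
  moreover have "F \<in> \<Delta>" using face_subset[OF assms(1) v(2)] by auto
  moreover have "finite F" using finite_face[OF assms(1) \<open>F \<in> \<Delta>\<close>] .
  ultimately show "F \<in> \<Delta> \<and> face_dim F = i - 1" by (simp add: face_dim_def)
qed

lemma trivial_group_Mod_iff: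
  fixes G (structure)
  assumes "comm_group G" "subgroup H G"
  shows "trivial_group (G Mod H) \<longleftrightarrow> carrier G \<subseteq> H"
proof -
  interpret comm_group G by (rule assms(1))
  interpret N: normal H G using assms(2) by (rule subgroup_imp_normal)
  have "trivial_group (G Mod H) \<longleftrightarrow> carrier (G Mod H) = {H}"
    using N.factorgroup_is_group by (simp add: trivial_group_def)
  also have "\<dots> \<longleftrightarrow> (\<forall>x\<in>carrier G. H #> x = H)"
    by (auto simp: FactGroup_def RCOSETS_def)
  also have "\<dots> \<longleftrightarrow> carrier G \<subseteq> H"
    using coset_join1[OF _ _ assms(2)] coset_join2[OF _ assms(2)] N.subset by blast
  finally show ?thesis .
qed

lemma trivial_reduced_homology_iff:
  fixes \<Delta> :: "'a::linorder set set"
  assumes "simplicial_complex \<Delta>" "finite U" "\<Union>\<Delta> \<subseteq> U"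
  shows "trivial_group (reduced_homology TYPE('k::field) \<Delta> i) \<longleftrightarrow> exact_at TYPE('k) U \<Delta> i"
proof -
  let ?G = "cycle_group \<Delta> i :: ('a set \<Rightarrow> 'k) monoid"
  let ?H = "boundaries \<Delta> i :: ('a set \<Rightarrow> 'k) set"
  have bd: "boundary_map \<Delta> c = boundary U c" if "c \<in> chains \<Delta> j" for c :: "'a set \<Rightarrow> 'k" and j
    using boundary_map_eq_boundary[OF finite_complex[OF assms(1)] assms(2,3) that] .
  have G: "carrier ?G = {c \<in> chains \<Delta> i. boundary U c = (\<lambda>_. 0)}"
    using bd by (auto simp: cycle_group_def)
  have H: "?H = boundary U ` chains \<Delta> (i + 1)"
    using bd by (auto simp: boundaries_def image_iff)
  have bd_cycle: "boundary U c \<in> carrier ?G" if c: "c \<in> chains \<Delta> (i + 1)" for c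
    unfolding G using boundary_in_chains[OF assms(1) c, of U]
      boundary_boundary[OF assms(2) chains_infinite[OF assms(1) c]] by simp
  have "comm_group ?G"
  proof (rule comm_groupI)
    fix c assume "c \<in> carrier ?G"
    then show "\<exists>d\<in>carrier ?G. d \<otimes>\<^bsub>?G\<^esub> c = \<one>\<^bsub>?G\<^esub>"
      unfolding G
      by (intro bexI[of _ "\<lambda>F. - c F"]) (auto simp: cycle_group_def chains_minus boundary_minus)
  next
    fix c d assume "c \<in> carrier ?G" "d \<in> carrier ?G"
    then show "c \<otimes>\<^bsub>?G\<^esub> d \<in> carrier ?G"
      unfolding G by (auto simp: cycle_group_def chains_add boundary_add)
  next
    show "\<one>\<^bsub>?G\<^esub> \<in> carrier ?G" unfolding G by (simp add: cycle_group_def)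
  qed (auto simp: cycle_group_def add.assoc add.commute)
  moreover have "subgroup ?H ?G"
  proof (rule group.subgroupI)
    show "group ?G" using \<open>comm_group ?G\<close> by (rule comm_group.axioms(2))
    show "?H \<subseteq> carrier ?G"
      unfolding H using bd_cycle by blast
    show "?H \<noteq> {}" unfolding H using chains_zero by blast
  next
    fix a assume "a \<in> ?H"
    then obtain c where c: "c \<in> chains \<Delta> (i + 1)" "a = boundary U c" unfolding H by blast
    have "a \<in> carrier ?G" unfolding c(2) using bd_cycle[OF c(1)] .
    moreover from this have "(\<lambda>F. - a F) \<in> carrier ?G"
      unfolding G by (simp add: chains_minus boundary_minus)
    moreover have "(\<lambda>F. - a F) \<otimes>\<^bsub>?G\<^esub> a = \<one>\<^bsub>?G\<^esub>" by (simp add: cycle_group_def)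
    ultimately have "inv\<^bsub>?G\<^esub> a = (\<lambda>F. - a F)"
      by (intro group.inv_equality[OF comm_group.axioms(2)[OF \<open>comm_group ?G\<close>]])
    also have "\<dots> = boundary U (\<lambda>F. - c F)" using c by (simp add: boundary_minus)
    finally show "inv\<^bsub>?G\<^esub> a \<in> ?H" unfolding H using chains_minus[OF c(1)] by blast
  next
    fix a b assume "a \<in> ?H" "b \<in> ?H"
    then obtain c d where c: "c \<in> chains \<Delta> (i + 1)" "a = boundary U c"
      and d: "d \<in> chains \<Delta> (i + 1)" "b = boundary U d" unfolding H by blast
    then have "a \<otimes>\<^bsub>?G\<^esub> b = boundary U (\<lambda>F. c F + d F)"
      by (simp add: cycle_group_def boundary_add)
    then show "a \<otimes>\<^bsub>?G\<^esub> b \<in> ?H" unfolding H using chains_add[OF c(1) d(1)] by blast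
  qed
  ultimately have "trivial_group (reduced_homology TYPE('k) \<Delta> i) \<longleftrightarrow> carrier ?G \<subseteq> ?H"
    unfolding reduced_homology_def by (rule trivial_group_Mod_iff)
  also have "\<dots> \<longleftrightarrow> exact_at TYPE('k) U \<Delta> i"
    unfolding G H exact_at_def by (auto simp: image_iff eq_commute)
  finally show ?thesis .
qed

lemma less_complex_dim_iff:
  assumes "simplicial_complex \<Delta>" "\<Delta> \<noteq> {}"
  shows "i < complex_dim \<Delta> \<longleftrightarrow> (\<exists>F\<in>\<Delta>. i < face_dim F)"
  unfolding complex_dim_def using assms finite_complex[OF assms(1)] by (simp add: Max_gr_iff)

lemma link_nonempty: "\<sigma> \<in> \<Delta> \<Longrightarrow> simplicial_complex \<Delta> \<Longrightarrow> link \<Delta> \<sigma> \<noteq> {}"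
  using face_subset[of \<Delta> \<sigma> "{}"] by (auto simp: link_def)

lemma cohen_macaulay_iff:
  fixes \<Delta> :: "'a::linorder set set"
  assumes "simplicial_complex \<Delta>" "finite U" "\<Union>\<Delta> \<subseteq> U"
  shows "cohen_macaulay TYPE('k::field) \<Delta> \<longleftrightarrow>
    (\<forall>\<sigma>\<in>\<Delta>. \<forall>F\<in>link \<Delta> \<sigma>. \<forall>i < face_dim F. exact_at TYPE('k) U (link \<Delta> \<sigma>) i)"
proof -
  have "\<Union>(link \<Delta> \<sigma>) \<subseteq> U" for \<sigma> using assms(3) by (auto simp: link_def)
  then have "trivial_group (reduced_homology TYPE('k) (link \<Delta> \<sigma>) i) \<longleftrightarrow>
      exact_at TYPE('k) U (link \<Delta> \<sigma>) i" for \<sigma> i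
    using trivial_reduced_homology_iff[OF simplicial_complex_link[OF assms(1)] assms(2)] by blast
  moreover have "i < complex_dim (link \<Delta> \<sigma>) \<longleftrightarrow> (\<exists>F\<in>link \<Delta> \<sigma>. i < face_dim F)"
    if "\<sigma> \<in> \<Delta>" for \<sigma> i
    using less_complex_dim_iff[OF simplicial_complex_link[OF assms(1)]]
      link_nonempty[OF that assms(1)] by blast
  ultimately show ?thesis unfolding cohen_macaulay_def by (metis (no_types))
qed

lemma exact_at_cone:
  fixes \<Delta> :: "'a::linorder set set"
  assumes "simplicial_complex \<Delta>" "finite U" "v \<in> U" "\<And>F. F \<in> \<Delta> \<Longrightarrow> insert v F \<in> \<Delta>"
  shows "exact_at TYPE('k::field) U \<Delta> i"
  unfolding exact_at_def
proof (intro allI impI)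
  fix c :: "'a set \<Rightarrow> 'k" assume c: "c \<in> chains \<Delta> i" "boundary U c = (\<lambda>_. 0)"
  have "cone v (\<lambda>_. 0 :: 'k) = (\<lambda>_. 0)" by (auto simp: cone_def)
  moreover have "boundary U (cone v c) F + cone v (boundary U c) F = c F" for F
    using boundary_cone[OF assms(2,3), of c F] chains_infinite[OF assms(1) c(1)] by blast
  ultimately have "boundary U (cone v c) = c" unfolding c(2) by auto
  moreover have "cone v c \<in> chains \<Delta> (i + 1)"
    unfolding chains_def
  proof (intro CollectI allI impI)
    fix F assume "cone v c F \<noteq> 0"
    then have F: "v \<in> F" "F - {v} \<in> \<Delta>" "face_dim (F - {v}) = i"
      using c(1) by (auto simp: cone_def chains_def split: if_splits)
    then have "F \<in> \<Delta>" using assms(4)[of "F - {v}"] by (simp add: insert_absorb)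
    then show "F \<in> \<Delta> \<and> face_dim F = i + 1"
      using F finite_face[OF assms(1)] card_Suc_Diff1[of F v] by (auto simp: face_dim_def)
  qed
  ultimately show "\<exists>b\<in>chains \<Delta> (i + 1). boundary U b = c" by blast
qed

text \<open>
  The relevant part of the Mayer-Vietoris sequence for the decomposition of \<open>\<Delta>\<close> into the deletion of
  \<open>v\<close> and the cone over its link. A cycle \<open>c\<close> splits as \<open>c\<^sub>0 + cone v c\<^sub>1\<close>, where \<open>c\<^sub>1\<close> is a cycle
  in the link. A bounding chain \<open>b\<close> of \<open>c\<^sub>1\<close> allows \<open>c\<close> to be replaced by the homologous cycle
  \<open>c + boundary (cone v b) = c\<^sub>0 + b\<close>, which avoids \<open>v\<close>.
\<close>

lemma exact_at_deletion_link:
  fixes \<Delta> :: "'a::linorder set set"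
  assumes sc: "simplicial_complex \<Delta>" and U: "finite U" "v \<in> U"
    and del: "exact_at TYPE('k::field) U (vertex_deletion \<Delta> v) i"
    and lk: "exact_at TYPE('k) U (link \<Delta> {v}) (i - 1)"
  shows "exact_at TYPE('k) U \<Delta> i"
  unfolding exact_at_def
proof (intro allI impI)
  fix c :: "'a set \<Rightarrow> 'k" assume c: "c \<in> chains \<Delta> i" "boundary U c = (\<lambda>_. 0)"
  let ?D = "vertex_deletion \<Delta> v" and ?L = "link \<Delta> {v}"
  define c0 where "c0 F = (if v \<in> F then 0 else c F)" for F
  define c1 where "c1 F = (if v \<in> F then 0 else incidence v F * c (insert v F))" for F
  have L_chains: "d (insert v F) = 0" "d F \<noteq> 0 \<Longrightarrow> v \<notin> F" if "d \<in> chains ?L j" for d :: "'a set \<Rightarrow> 'k" and j F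
    using that by (auto simp: chains_def link_def)
  have cone_L: "cone v d \<in> chains \<Delta> (j + 1)" if d: "d \<in> chains ?L j" for d :: "'a set \<Rightarrow> 'k" and j
    unfolding chains_def
  proof (intro CollectI allI impI)
    fix F assume "cone v d F \<noteq> 0"
    then have F: "v \<in> F" "F - {v} \<in> ?L" "face_dim (F - {v}) = j"
      using d by (auto simp: cone_def chains_def split: if_splits)
    then have "F \<in> \<Delta>" by (auto simp: link_def insert_absorb)
    then show "F \<in> \<Delta> \<and> face_dim F = j + 1"
      using F finite_face[OF sc] card_Suc_Diff1[of F v] by (auto simp: face_dim_def)
  qed
  have c0: "c0 \<in> chains ?D i"
    using c(1) by (auto simp: c0_def chains_def vertex_deletion_def split: if_splits)
  have c1: "c1 \<in> chains ?L (i - 1)"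
    unfolding chains_def
  proof (intro CollectI allI impI)
    fix F assume "c1 F \<noteq> 0"
    then have F: "v \<notin> F" "insert v F \<in> \<Delta>" "face_dim (insert v F) = i"
      using c(1) by (auto simp: c1_def chains_def split: if_splits)
    moreover have "F \<in> \<Delta>" using face_subset[OF sc F(2)] by auto
    moreover have "finite F" using finite_face[OF sc \<open>F \<in> \<Delta>\<close>] .
    ultimately show "F \<in> ?L \<and> face_dim F = i - 1" by (simp add: link_def face_dim_def)
  qed
  have inc: "incidence v (F - {v}) = (incidence v F :: 'k)" if "v \<in> F" for F
    using incidence_insert_self[of v "F - {v}", where ?'k = 'k] that by (simp add: insert_absorb)
  have split: "c = (\<lambda>F. c0 F + cone v c1 F)"
    by (auto simp: c0_def c1_def cone_def inc insert_absorb mult.assoc[symmetric])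
  have inf0: "infinite F \<Longrightarrow> c1 F = 0" for F
    using chains_infinite[OF simplicial_complex_link[OF sc] c1] .
  have "boundary U c1 = (\<lambda>_. 0)"
  proof
    fix E
    show "boundary U c1 E = 0"
    proof (cases "v \<in> E")
      case True
      then show ?thesis by (auto simp: boundary_def c1_def intro!: sum.neutral)
    next
      case False
      \<comment> \<open>On faces containing \<open>v\<close> the boundary of \<open>c\<close> only involves the cone over the boundary of \<open>c\<^sub>1\<close>.\<close>
      let ?F = "insert v E"
      have "0 = boundary U c0 ?F + boundary U (cone v c1) ?F"
        using c(2) fun_cong[OF boundary_add[of U c0 "cone v c1"], of ?F] split by metis
      moreover have "boundary U c0 ?F = 0" by (auto simp: boundary_def c0_def intro!: sum.neutral)
      moreover have "boundary U (cone v c1) ?F + cone v (boundary U c1) ?F = 0"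
        using boundary_cone[OF U, of c1 ?F] inf0 by (simp add: c1_def)
      ultimately have "cone v (boundary U c1) ?F = 0" by simp
      then show ?thesis
        using False by (simp add: cone_def)
    qed
  qed
  then obtain b where b: "b \<in> chains ?L i" "boundary U b = c1"
    using lk c1 unfolding exact_at_def by force
  let ?e = "\<lambda>F. c0 F + b F"
  have "?L \<subseteq> ?D" by (auto simp: link_def vertex_deletion_def)
  then have e: "?e \<in> chains ?D i" using b(1) c0 chains_mono by (blast intro: chains_add)
  have infb: "infinite F \<Longrightarrow> b F = 0" for F
    using chains_infinite[OF simplicial_complex_link[OF sc] b(1)] .
  have e_eq: "?e = (\<lambda>F. c F + boundary U (cone v b) F)"
  proof
    fix F
    have "boundary U (cone v b) F + cone v c1 F = b F"
      using boundary_cone[OF U, of b F] infb b(2) by simp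
    moreover have "c F = c0 F + cone v c1 F" using split by metis
    ultimately show "?e F = c F + boundary U (cone v b) F" by (simp add: algebra_simps)
  qed
  have "boundary U ?e = (\<lambda>F. boundary U c F + boundary U (boundary U (cone v b)) F)"
    unfolding e_eq by (rule boundary_add)
  also have "\<dots> = (\<lambda>_. 0)"
    using c(2) boundary_boundary[OF U(1) chains_infinite[OF sc cone_L[OF b(1)]]] by simp
  finally obtain a where a: "a \<in> chains ?D (i + 1)" "boundary U a = ?e"
    using del e unfolding exact_at_def by blast
  have "?D \<subseteq> \<Delta>" by (auto simp: vertex_deletion_def)
  then have "(\<lambda>F. a F + - cone v b F) \<in> chains \<Delta> (i + 1)"
    using chains_add[OF _ chains_minus[OF cone_L[OF b(1)]]] a(1) chains_mono by blast
  moreover have "boundary U (\<lambda>F. a F + - cone v b F) = c"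
    using a(2) e_eq by (auto simp: boundary_diff dest: fun_cong)
  ultimately show "\<exists>b\<in>chains \<Delta> (i + 1). boundary U b = c" by blast
qed

text \<open>
  If \<open>P\<close> and its complement disconnect the graph formed by the edges of \<open>\<Delta>\<close>, then the sum of the
  coefficients at the vertices of \<open>P\<close> vanishes on all boundaries, but not on the cycle \<open>x - y\<close>.
\<close>

lemma not_exact_at_disconnected:
  fixes \<Delta> :: "'a::linorder set set"
  assumes sc: "simplicial_complex \<Delta>" and U: "finite U" "\<Union>\<Delta> \<subseteq> U"
    and xy: "{x} \<in> \<Delta>" "{y} \<in> \<Delta>" "x \<in> P" "y \<notin> P"
    and edges: "\<And>F. F \<in> \<Delta> \<Longrightarrow> card F = 2 \<Longrightarrow> F \<subseteq> P \<or> F \<inter> P = {}"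
  shows "\<not> exact_at TYPE('k::field) U \<Delta> 0"
proof
  assume exact: "exact_at TYPE('k) U \<Delta> 0"
  define c :: "'a set \<Rightarrow> 'k" where "c F = (if F = {x} then 1 else if F = {y} then - 1 else 0)" for F
  have "x \<noteq> y" "x \<in> U" "y \<in> U" using xy U(2) by auto
  have c: "c \<in> chains \<Delta> 0" using xy by (auto simp: chains_def c_def face_dim_def)
  have "boundary U c = (\<lambda>_. 0)"
  proof
    fix F
    show "boundary U c F = 0"
    proof (cases "F = {}")
      case True
      have "boundary U c {} = (\<Sum>v\<in>U. (if v = x then 1 else 0) - (if v = y then 1 else 0))"
        unfolding boundary_def using \<open>x \<noteq> y\<close> by (intro sum.cong) (auto simp: c_def)
      also have "\<dots> = 0" using U(1) \<open>x \<in> U\<close> \<open>y \<in> U\<close> by (simp add: sum_subtractf)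
      finally show ?thesis using True by simp
    next
      case False
      then have "F \<in> \<Delta> \<Longrightarrow> face_dim F = 0 - 1 \<Longrightarrow> False"
        using finite_face[OF sc] by (simp add: face_dim_def)
      then show ?thesis using boundary_in_chains[OF sc c, of U] by (auto simp: chains_def)
    qed
  qed
  then obtain b where b: "b \<in> chains \<Delta> 1" "boundary U b = c"
    using exact c unfolding exact_at_def by force
  define Q where "Q = U \<inter> P"
  have "(\<Sum>v\<in>Q. boundary U b {v}) = (\<Sum>v\<in>Q. \<Sum>w\<in>Q - {v}. incidence w {v} * b {w, v})"
  proof (intro sum.cong refl)
    fix v assume v: "v \<in> Q"
    have "w \<in> P" if "b {w, v} \<noteq> 0" for w
    proof -
      have "{w, v} \<in> \<Delta>" "card {w, v} = 2"
        using that b(1) by (auto simp: chains_def face_dim_def)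
      then show ?thesis using edges[of "{w, v}"] v by (auto simp: Q_def)
    qed
    then show "boundary U b {v} = (\<Sum>w\<in>Q - {v}. incidence w {v} * b {w, v})"
      unfolding boundary_def Q_def using U(1) by (intro sum.mono_neutral_right) auto
  qed
  also have "\<dots> = 0"
  proof (rule sum_antisymmetric)
    fix v w assume "v \<in> Q" "w \<in> Q" "v \<noteq> w"
    then show "incidence w {v} * b {w, v} = - (incidence v {w} * b {v, w})"
      using incidence_swap[of "{}" v w, where ?'k = 'k] by (simp add: insert_commute)
  qed (use U(1) in \<open>simp add: Q_def\<close>)
  also have "(\<Sum>v\<in>Q. boundary U b {v}) = (\<Sum>v\<in>Q. if v = x then 1 else 0)"
    unfolding b(2) using xy(4) by (intro sum.cong) (auto simp: c_def Q_def)
  also have "\<dots> = 1" using U(1) \<open>x \<in> U\<close> xy(3) by (simp add: Q_def)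
  finally show False by simp
qed


section \<open>Matroid complexes are Cohen--Macaulay\<close>

definition matroid_complex :: "'a set set \<Rightarrow> bool" where
  "matroid_complex \<Delta> \<longleftrightarrow> simplicial_complex \<Delta> \<and> \<Delta> \<noteq> {} \<and>
     (\<forall>F\<in>\<Delta>. \<forall>F'\<in>\<Delta>. card F < card F' \<longrightarrow> (\<exists>x\<in>F' - F. insert x F \<in> \<Delta>))"

lemma matroid_complex_augment:
  assumes "matroid_complex \<Delta>" "E \<in> \<Delta>" "F \<in> \<Delta>" "card E \<le> card F"
  shows "\<exists>E'\<in>\<Delta>. E \<subseteq> E' \<and> card E' = card F"
  using assms(2,4)
proof (induction "card F - card E" arbitrary: E)
  case 0
  then show ?case by auto
next
  case (Suc k)
  then have "card E < card F" by simp
  then obtain x where x: "x \<in> F - E" "insert x E \<in> \<Delta>"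
    using assms(1,3) Suc.prems unfolding matroid_complex_def by blast
  have "finite E" using finite_face assms(1) Suc.prems unfolding matroid_complex_def by blast
  then have "card (insert x E) = Suc (card E)" using x by simp
  then have "\<exists>E'\<in>\<Delta>. insert x E \<subseteq> E' \<and> card E' = card F"
    using Suc.hyps(2) \<open>card E < card F\<close> x(2) by (intro Suc.hyps(1)) simp_all
  then show ?case by blast
qed

lemma matroid_complex_link:
  assumes "matroid_complex \<Delta>" "\<sigma> \<in> \<Delta>"
  shows "matroid_complex (link \<Delta> \<sigma>)"
proof -
  have sc: "simplicial_complex \<Delta>" using assms(1) by (simp add: matroid_complex_def)
  have "\<exists>x\<in>F' - F. insert x F \<in> link \<Delta> \<sigma>"
    if F: "F \<in> link \<Delta> \<sigma>" "F' \<in> link \<Delta> \<sigma>" "card F < card F'" for F F'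
  proof -
    have *: "\<sigma> \<union> F \<in> \<Delta>" "\<sigma> \<union> F' \<in> \<Delta>" "\<sigma> \<inter> F = {}" "\<sigma> \<inter> F' = {}" using F by (auto simp: link_def)
    then have "finite (\<sigma> \<union> F)" "finite (\<sigma> \<union> F')" using finite_face[OF sc] by blast+
    then have "card (\<sigma> \<union> F) < card (\<sigma> \<union> F')" using * F(3) by (simp add: card_Un_disjoint)
    then obtain x where x: "x \<in> (\<sigma> \<union> F') - (\<sigma> \<union> F)" "insert x (\<sigma> \<union> F) \<in> \<Delta>"
      using assms(1) * unfolding matroid_complex_def by blast
    moreover have "insert x F \<in> \<Delta>" using face_subset[OF sc x(2)] by auto
    ultimately show ?thesis using * by (auto simp: link_def)
  qed
  then show ?thesis
    using simplicial_complex_link[OF sc] link_nonempty[OF assms(2) sc]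
    by (simp add: matroid_complex_def)
qed

lemma matroid_complex_vertex_deletion:
  assumes "matroid_complex \<Delta>"
  shows "matroid_complex (vertex_deletion \<Delta> v)"
proof -
  have "{} \<in> \<Delta>" using assms face_subset unfolding matroid_complex_def by blast
  then have "{} \<in> vertex_deletion \<Delta> v" by (simp add: vertex_deletion_def)
  moreover have "\<exists>x\<in>F' - F. insert x F \<in> vertex_deletion \<Delta> v"
    if F: "F \<in> vertex_deletion \<Delta> v" "F' \<in> vertex_deletion \<Delta> v" "card F < card F'" for F F'
  proof -
    have "\<exists>x\<in>F' - F. insert x F \<in> \<Delta>"
      using assms F unfolding matroid_complex_def vertex_deletion_def by blast
    then show ?thesis using F by (auto simp: vertex_deletion_def)
  qed
  ultimately show ?thesis
    using assms simplicial_complex_vertex_deletion[of \<Delta> v]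
    unfolding matroid_complex_def by blast
qed

text \<open>
  Induction on the number of vertices. Unless \<open>\<Delta>\<close> is a cone with apex \<open>v\<close>, some maximal face avoids
  \<open>v\<close>, so by augmentation the deletion of \<open>v\<close> has the dimension of \<open>\<Delta>\<close>, while the dimension of the
  link drops by exactly one; so both are exact in the degrees needed for the Mayer-Vietoris argument.
\<close>

proposition matroid_complex_exact_at:
  fixes \<Delta> :: "'a::linorder set set"
  assumes "matroid_complex \<Delta>" "finite U" "\<Union>\<Delta> \<subseteq> U" "F \<in> \<Delta>" "i < face_dim F"
  shows "exact_at TYPE('k::field) U \<Delta> i"
  using assms
proof (induction "card (\<Union>\<Delta>)" arbitrary: \<Delta> F i rule: less_induct)
  case less
  have sc: "simplicial_complex \<Delta>" using less.prems(1) by (simp add: matroid_complex_def)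
  show ?case
  proof (cases "\<Union>\<Delta> = {}")
    case True
    then have "F = {}" using less.prems(4) by blast
    then have "i < - 1" using less.prems(5) by (simp add: face_dim_def)
    then have "c = (\<lambda>_. 0)" if "c \<in> chains \<Delta> i" for c :: "'a set \<Rightarrow> 'k"
      using that by (fastforce simp: chains_def face_dim_def)
    then show ?thesis unfolding exact_at_def using chains_zero boundary_zero by metis
  next
    case False
    then obtain v where "v \<in> \<Union>\<Delta>" by blast
    then have v: "{v} \<in> \<Delta>" "v \<in> U" using face_subset[OF sc] less.prems(3) by blast+
    let ?D = "vertex_deletion \<Delta> v" and ?L = "link \<Delta> {v}"
    show ?thesis
    proof (cases "\<forall>E\<in>\<Delta>. insert v E \<in> \<Delta>")
      case True
      then show ?thesis using exact_at_cone[OF sc less.prems(2) v(2)] by blast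
    next
      case noncone: False
      then obtain E where E: "E \<in> \<Delta>" "insert v E \<notin> \<Delta>" by blast
      have avoid: "v \<notin> E'" if "E' \<in> \<Delta>" "E \<subseteq> E'" for E'
      proof
        assume "v \<in> E'"
        then have "insert v E \<in> \<Delta>" using face_subset[OF sc that(1)] that(2) by simp
        with E(2) show False ..
      qed
      have D_sub: "\<Union>?D \<subseteq> \<Union>\<Delta> - {v}" by (auto simp: vertex_deletion_def)
      have L_sub: "\<Union>?L \<subseteq> \<Union>\<Delta> - {v}" by (auto simp: link_def)
      have "finite (\<Union>\<Delta>)" using sc by (simp add: simplicial_complex_def)
      then have smaller: "card (\<Union>?D) < card (\<Union>\<Delta>)" "card (\<Union>?L) < card (\<Union>\<Delta>)"
        using D_sub L_sub \<open>v \<in> \<Union>\<Delta>\<close> by (blast intro: psubset_card_mono)+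
      obtain E' where E': "E' \<in> ?D" "i < face_dim E'"
      proof (cases "card E \<le> card F")
        case True
        obtain E' where "E' \<in> \<Delta>" "E \<subseteq> E'" "card E' = card F"
          using matroid_complex_augment[OF less.prems(1) E(1) less.prems(4) True] by blast
        then show ?thesis
          using that[of E'] avoid less.prems(5) by (simp add: vertex_deletion_def face_dim_def)
      next
        case False
        then show ?thesis
          using that[of E] avoid E(1) less.prems(5) by (simp add: vertex_deletion_def face_dim_def)
      qed
      obtain F' where F': "F' \<in> ?L" "i - 1 < face_dim F'"
      proof (cases "card F = 0")
        case True
        then show ?thesis
          using that[of "{}"] v(1) face_subset[OF sc v(1), of "{}"] less.prems(5)
          by (simp add: link_def face_dim_def)
      next
        case False
        then have "card {v} \<le> card F" by simp
        then obtain G where G: "G \<in> \<Delta>" "{v} \<subseteq> G" "card G = card F"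
          using matroid_complex_augment[OF less.prems(1) v(1) less.prems(4)] by blast
        have "G - {v} \<in> ?L"
          using G face_subset[OF sc G(1)] by (auto simp: link_def insert_absorb)
        moreover have "card G = Suc (card (G - {v}))"
          using G(2) finite_face[OF sc G(1)] card_Suc_Diff1[of G v] by simp
        ultimately show ?thesis
          using that[of "G - {v}"] G(3) less.prems(5) by (simp add: face_dim_def)
      qed
      have "exact_at TYPE('k) U ?D i"
        using less.hyps[OF smaller(1) matroid_complex_vertex_deletion less.prems(2) _ E']
          less.prems(1,3) D_sub by blast
      moreover have "exact_at TYPE('k) U ?L (i - 1)"
        using less.hyps[OF smaller(2) matroid_complex_link less.prems(2) _ F']
          less.prems(1,3) L_sub v(1) by blast
      ultimately show ?thesis
        using exact_at_deletion_link[OF sc less.prems(2) v(2)] by blast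
    qed
  qed
qed

corollary matroid_complex_cohen_macaulay:
  fixes \<Delta> :: "'a::linorder set set"
  assumes "matroid_complex \<Delta>"
  shows "cohen_macaulay TYPE('k::field) \<Delta>"
proof -
  have sc: "simplicial_complex \<Delta>" using assms by (simp add: matroid_complex_def)
  have fin: "finite (\<Union>\<Delta>)" using sc by (simp add: simplicial_complex_def)
  have sub: "\<Union>(link \<Delta> \<sigma>) \<subseteq> \<Union>\<Delta>" for \<sigma> by (auto simp: link_def)
  show ?thesis
    unfolding cohen_macaulay_iff[OF sc fin subset_refl]
    using matroid_complex_exact_at[OF matroid_complex_link[OF assms] fin sub] by blast
qed

text \<open>
  If it is not void, the pure skeleton of dimension \<open>p - 1\<close> consists of the sets with at most \<open>p\<close>
  elements that, in case \<open>p > r\<close>, contain fewer than \<open>h\<close> elements of \<open>B\<close>. These are the independent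
  sets of a matroid: a set that is to be augmented gets an element outside \<open>B\<close> if possible, and
  otherwise it contains fewer elements of \<open>B\<close> than the larger set does.
\<close>

proposition sequentially_cohen_macaulay_bounded_complex:
  fixes U :: "'a::linorder set"
  assumes "finite U"
  shows "sequentially_cohen_macaulay TYPE('k::field) (bounded_complex U B r h)"
  unfolding sequentially_cohen_macaulay_def
proof
  fix d
  let ?S = "pure_skeleton d (bounded_complex U B r h)"
  define p where "p = Suc d"
  have dim: "face_dim F = int d \<longleftrightarrow> card F = p" for F :: "'a set"
    by (auto simp: face_dim_def p_def)
  show "cohen_macaulay TYPE('k) ?S"
  proof (cases "?S = {}")
    case True
    then show ?thesis by (simp add: cohen_macaulay_def)
  next
    case False
    then obtain F0 where F0: "F0 \<in> bounded_complex U B r h" "card F0 = p"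
      unfolding pure_skeleton_def dim by blast
    define M where "M = {F. F \<subseteq> U \<and> card F \<le> p \<and> (p \<le> r \<or> card (F \<inter> B) < h)}"
    have fin: "finite F" if "F \<subseteq> U" for F using finite_subset[OF that assms] .
    have down: "F' \<in> M" if F: "F \<in> M" "F' \<subseteq> F" for F F'
    proof -
      have "finite F" using F(1) fin by (simp add: M_def)
      then have "card F' \<le> card F" "card (F' \<inter> B) \<le> card (F \<inter> B)"
        using F(2) by (auto intro!: card_mono)
      then show ?thesis using F by (auto simp: M_def)
    qed
    have top: "F \<in> M \<longleftrightarrow> F \<in> bounded_complex U B r h" if "card F = p" for F
      using that by (auto simp: M_def bounded_complex_def)
    have "\<Union>M \<subseteq> U" by (auto simp: M_def)
    then have "finite (\<Union>M)" using assms by (rule finite_subset)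
    then have sc: "simplicial_complex M"
      using down unfolding simplicial_complex_def by blast
    have "\<exists>x\<in>F' - F. insert x F \<in> M" if F: "F \<in> M" "F' \<in> M" "card F < card F'" for F F'
    proof -
      have finF: "finite F" "finite F'" using F fin by (auto simp: M_def)
      have "\<not> F' \<subseteq> F" using card_mono[OF finF(1), of F'] F(3) by linarith
      then obtain y where y: "y \<in> F' - F" by blast
      obtain x where x: "x \<in> F' - F" "p \<le> r \<or> x \<notin> B \<or> card (F \<inter> B) < card (F' \<inter> B)"
      proof (cases "F' - F \<subseteq> B")
        case True
        then have "card (F' - B) \<le> card (F - B)" using finF by (intro card_mono) auto
        moreover have "card F = card (F \<inter> B) + card (F - B)" "card F' = card (F' \<inter> B) + card (F' - B)"
          using card_Int_Diff finF by blast+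
        ultimately have "card (F \<inter> B) < card (F' \<inter> B)" using F(3) by linarith
        then show ?thesis using that[OF y] by blast
      next
        case False
        then show ?thesis using that by blast
      qed
      have "card (insert x F \<inter> B) \<le> (if x \<in> B then Suc (card (F \<inter> B)) else card (F \<inter> B))"
        using finF by (simp add: card_insert_le_m1 card_insert_if)
      then have "p \<le> r \<or> card (insert x F \<inter> B) < h"
        using x F by (auto simp: M_def split: if_splits)
      moreover have "card (insert x F) \<le> p" using x finF F by (simp add: M_def)
      ultimately have "insert x F \<in> M" using x F by (auto simp: M_def)
      then show ?thesis using x(1) by blast
    qed
    moreover have F0M: "F0 \<in> M" using F0 top by blast
    ultimately have matroid: "matroid_complex M" using sc unfolding matroid_complex_def by blast
    have "?S = M"
    proof
      show "?S \<subseteq> M" using top down unfolding pure_skeleton_def dim by blast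
      show "M \<subseteq> ?S"
      proof
        fix F assume F: "F \<in> M"
        then have "card F \<le> card F0" using F0(2) by (simp add: M_def)
        then obtain F' where "F' \<in> M" "F \<subseteq> F'" "card F' = p"
          using matroid_complex_augment[OF matroid F F0M] F0(2) by metis
        then show "F \<in> ?S" using top unfolding pure_skeleton_def dim by blast
      qed
    qed
    then show ?thesis using matroid_complex_cohen_macaulay[OF matroid] by simp
  qed
qed


section \<open>Obstructions from two large parts\<close>

lemma ex_subset_card: "n \<le> card A \<Longrightarrow> \<exists>S\<subseteq>A. card S = n"
  by (meson obtain_subset_with_card_n)

text \<open>
  If two parts \<open>V a\<close>, \<open>V b\<close> have more than \<open>t - t div 2\<close> elements each, then some faces with \<open>t\<close>
  elements have fewer than \<open>t div 2\<close> of them outside \<open>V a\<close>, and some have fewer than \<open>t div 2\<close> outside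
  \<open>V b\<close>. Two faces of these different kinds share at most \<open>2 * (t div 2 - 1) < t - 1\<close> elements.
\<close>

locale two_large_parts =
  fixes U :: "'a::linorder set" and I :: "nat set" and V :: "nat \<Rightarrow> 'a set" and t a b :: nat
  assumes finite_U: "finite U"
    and V_sub: "i \<in> I \<Longrightarrow> V i \<subseteq> U"
    and disj: "disjoint_family_on V I"
    and ab: "a \<in> I" "b \<in> I" "a \<noteq> b"
    and large: "t - t div 2 < card (V a)" "t - t div 2 < card (V b)"
    and t2: "t \<ge> 2"
begin

abbreviation D :: "'a set set" where
  "D \<equiv> {F. F \<subseteq> U \<and> (card F < t \<or> (\<exists>i\<in>I. card (F - V i) < t div 2))}"

lemma fin: "F \<subseteq> U \<Longrightarrow> finite F"
  using finite_U finite_subset by blast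

lemma disjoint: "i \<in> I \<Longrightarrow> j \<in> I \<Longrightarrow> i \<noteq> j \<Longrightarrow> V i \<inter> V j = {}"
  using disj unfolding disjoint_family_on_def by blast

lemma large_faces_disjoint_kinds:
  assumes "F \<subseteq> U" "F' \<subseteq> U" "i \<in> I" "j \<in> I" "i \<noteq> j"
    "card (F - V i) < t div 2" "card (F' - V j) < t div 2"
  shows "card (F \<inter> F') + 1 < t"
proof -
  have "F \<inter> F' \<subseteq> (F - V i) \<union> (F' - V j)" using disjoint[OF assms(3-5)] by blast
  then have "card (F \<inter> F') \<le> card ((F - V i) \<union> (F' - V j))"
    using assms(1,2) fin by (intro card_mono) auto
  also have "\<dots> \<le> card (F - V i) + card (F' - V j)" by (rule card_Un_le)
  finally show ?thesis using assms(6,7) by linarith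
qed

text \<open>
  The sets \<open>P\<close> and \<open>R\<close> are the largest possible traces of a face of one kind on the part of the other,
  so that \<open>P \<union> R\<close> extends to faces of both kinds.
\<close>

lemma extend_to_face:
  assumes ij: "i \<in> I" "j \<in> I" "i \<noteq> j" and large: "t - t div 2 < card (V i)"
    and P: "P \<subseteq> V i" "card P = t div 2 - 1" and R: "R \<subseteq> V j" "card R = t div 2 - 1"
  obtains Z where "Z \<subseteq> V i - P" "card Z \<ge> 2" "P \<union> R \<union> Z \<in> D" "card (P \<union> R \<union> Z) = t"
    "card (P \<union> R \<union> Z - V i) < t div 2"
proof -
  have sub: "V i \<subseteq> U" "P \<subseteq> U" "R \<subseteq> U" using V_sub ij P R by blast+
  have "card (V i - P) = card (V i) - card P"
    using P(1) fin[OF sub(2)] by (rule card_Diff_subset[rotated])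
  then have "t - 2 * (t div 2 - 1) \<le> card (V i - P)" using large P(2) t2 by linarith
  then obtain Z where Z: "Z \<subseteq> V i - P" "card Z = t - 2 * (t div 2 - 1)"
    using ex_subset_card by metis
  have ZU: "Z \<subseteq> U" using Z(1) sub(1) by blast
  have "P \<inter> R = {}" "(P \<union> R) \<inter> Z = {}" using P R Z disjoint[OF ij] by blast+
  then have "card (P \<union> R \<union> Z) = card P + card R + card Z"
    using sub ZU fin by (simp add: card_Un_disjoint)
  then have "card (P \<union> R \<union> Z) = t" using P(2) R(2) Z(2) t2 by linarith
  moreover have "card (P \<union> R \<union> Z - V i) \<le> card R"
    using P(1) Z(1) fin[OF sub(3)] by (intro card_mono) auto
  then have "card (P \<union> R \<union> Z - V i) < t div 2" using R(2) t2 by linarith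
  moreover have "P \<union> R \<union> Z \<in> D" using sub ZU ij(1) calculation by blast
  moreover have "card Z \<ge> 2" using Z(2) t2 by linarith
  ultimately show thesis using that[OF Z(1)] by blast
qed

lemma ex_cores:
  obtains X Y where "X \<subseteq> V a" "card X = t div 2 - 1" "Y \<subseteq> V b" "card Y = t div 2 - 1"
proof -
  have "t div 2 - 1 \<le> card (V a)" "t div 2 - 1 \<le> card (V b)" using large by linarith+
  then show thesis using that ex_subset_card by metis
qed

text \<open>
  Adjacent faces with \<open>t\<close> elements share \<open>t - 1\<close> of them, hence are of the same kind, and no chain of
  adjacent faces leads from one kind to the other.
\<close>

lemma not_shellable: "\<not> shellable D"
proof
  assume shell: "shellable D"
  obtain X Y where XY: "X \<subseteq> V a" "card X = t div 2 - 1" "Y \<subseteq> V b" "card Y = t div 2 - 1"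
    using ex_cores .
  obtain F where F: "F \<in> D" "card F = t" "card (F - V a) < t div 2"
    by (rule extend_to_face[OF ab large(1) XY]) (rule that)
  obtain F' where F': "F' \<in> D" "card F' = t" "card (F' - V b) < t div 2"
    by (rule extend_to_face[OF ab(2,1) ab(3)[symmetric] large(2) XY(3,4,1,2)]) (rule that)
  have "(F, F') \<in> (ridge_adjacent t D)\<^sup>*"
    using shellable_strongly_connected[OF shell F(1) F'(1) F(2) F'(2)] .
  then have "card (F' - V a) < t div 2"
  proof (induction rule: rtrancl_induct)
    case base
    show ?case by (rule F(3))
  next
    case (step G H)
    have GH: "G \<subseteq> U" "H \<subseteq> U" "t \<le> card (G \<inter> H) + 1" "card H = t" "H \<in> D"
      using step.hyps(2) by (auto simp: ridge_adjacent_def)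
    then obtain i where i: "i \<in> I" "card (H - V i) < t div 2" by auto
    have "i = a"
      using large_faces_disjoint_kinds[OF GH(1,2) ab(1) i(1) _ step.IH i(2)] GH(3) by force
    then show ?case using i(2) by simp
  qed
  moreover have "F' \<subseteq> U" using F'(1) by simp
  ultimately show False
    using large_faces_disjoint_kinds[of F' F' a b] ab F' by simp
qed

text \<open>
  Take \<open>t div 2 - 1\<close> elements from each of the two parts. A face with \<open>t\<close> elements containing all
  of them has its two or three other elements in one part. So the link of this face in the
  skeleton is disconnected, although it has positive dimension.
\<close>

lemma not_sequentially_cohen_macaulay: "\<not> sequentially_cohen_macaulay TYPE('k::field) D"
proof
  assume "sequentially_cohen_macaulay TYPE('k) D"
  then have cm: "cohen_macaulay TYPE('k) (pure_skeleton (t - 1) D)"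
    by (simp add: sequentially_cohen_macaulay_def)
  define S where "S = {F. \<exists>G\<in>D. card G = t \<and> F \<subseteq> G}"
  have "face_dim F = int (t - 1) \<longleftrightarrow> card F = t" for F :: "'a set"
    using t2 by (auto simp: face_dim_def)
  then have S: "pure_skeleton (t - 1) D = S" by (simp add: pure_skeleton_def S_def)
  have "\<Union>S \<subseteq> U" by (auto simp: S_def)
  then have sc: "simplicial_complex S"
    using fin unfolding simplicial_complex_def S_def by blast
  obtain X Y where XY: "X \<subseteq> V a" "card X = t div 2 - 1" "Y \<subseteq> V b" "card Y = t div 2 - 1"
    using ex_cores .
  let ?\<sigma> = "X \<union> Y" and ?L = "link S (X \<union> Y)"
  obtain Z where Z: "Z \<subseteq> V a - X" "card Z \<ge> 2" "?\<sigma> \<union> Z \<in> D" "card (?\<sigma> \<union> Z) = t"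
    by (rule extend_to_face[OF ab large(1) XY]) (rule that)
  obtain Z' where Z': "Z' \<subseteq> V b - Y" "card Z' \<ge> 2" "?\<sigma> \<union> Z' \<in> D" "card (?\<sigma> \<union> Z') = t"
    by (rule extend_to_face[OF ab(2,1) ab(3)[symmetric] large(2) XY(3,4,1,2)])
      (rule that, simp_all only: Un_commute[of Y X])
  have in_link: "F \<in> ?L" if "F \<subseteq> W" "W \<inter> ?\<sigma> = {}" "?\<sigma> \<union> W \<in> D" "card (?\<sigma> \<union> W) = t" for F W
    using that unfolding link_def S_def by blast
  have Z\<sigma>: "Z \<inter> ?\<sigma> = {}" "Z' \<inter> ?\<sigma> = {}" using Z(1) Z'(1) XY(1,3) disjoint[OF ab] by blast+
  have ZL: "F \<in> ?L" if "F \<subseteq> Z \<or> F \<subseteq> Z'" for F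
    using that in_link[OF _ Z\<sigma>(1) Z(3,4)] in_link[OF _ Z\<sigma>(2) Z'(3,4)] by metis
  obtain x y where xy: "x \<in> Z" "y \<in> Z'" using Z(2) Z'(2) by fastforce
  have one_part: "\<exists>i\<in>I. G - ?\<sigma> \<subseteq> V i" if G: "G \<in> D" "card G = t" "?\<sigma> \<subseteq> G" for G
  proof -
    obtain i where i: "i \<in> I" "card (G - V i) < t div 2" using G by auto
    have finG: "finite (G - V i)" using G(1) fin by blast
    have eq: "W = G - V i" if "W \<subseteq> G - V i" "card W = t div 2 - 1" for W
      using card_seteq[OF finG that(1)] that(2) i(2) by linarith
    have "G - V i \<subseteq> ?\<sigma>"
    proof (cases "i = a")
      case True
      then have "Y \<subseteq> G - V i" using XY(3) G(3) disjoint[OF ab] by blast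
      then show ?thesis using eq[of Y] XY(4) by blast
    next
      case False
      then have "X \<subseteq> G - V i" using XY(1) G(3) disjoint[OF ab(1) i(1)] by blast
      then show ?thesis using eq[of X] XY(2) by blast
    qed
    then show ?thesis using i(1) by blast
  qed
  have split: "F \<subseteq> V a \<or> F \<inter> V a = {}" if F: "F \<in> ?L" for F
  proof -
    obtain G where "G \<in> D" "card G = t" "?\<sigma> \<union> F \<subseteq> G" "?\<sigma> \<inter> F = {}"
      using F unfolding link_def S_def by blast
    then obtain i where "i \<in> I" "F \<subseteq> V i" using one_part[of G] by blast
    then show ?thesis using disjoint[OF _ ab(1), of i] by blast
  qed
  have xy': "x \<in> V a" "y \<notin> V a" using xy Z(1) Z'(1) disjoint[OF ab] by blast+
  have xyL: "{x} \<in> ?L" "{y} \<in> ?L" using ZL xy by blast+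
  have LU: "\<Union>?L \<subseteq> U" using \<open>\<Union>S \<subseteq> U\<close> by (auto simp: link_def)
  have "\<not> exact_at TYPE('k) U ?L 0"
    by (rule not_exact_at_disconnected[OF simplicial_complex_link[OF sc] finite_U LU xyL xy' split])
  moreover have "?\<sigma> \<in> S" using Z(3,4) unfolding S_def by blast
  moreover have "0 < face_dim Z" using Z(2) by (simp add: face_dim_def)
  ultimately show False
    using cm ZL[of Z] unfolding S cohen_macaulay_iff[OF sc finite_U \<open>\<Union>S \<subseteq> U\<close>] by blast
qed

end


section \<open>Path-free complexes of complete multipartite graphs\<close>

text \<open>
  A face with at least \<open>t\<close> elements, fewer than \<open>t div 2\<close> of them outside \<open>V i\<close>, has more than
  \<open>t - t div 2\<close> elements in \<open>V i\<close>; if only \<open>V j\<close> can be that large, then \<open>i = j\<close>.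
\<close>

lemma path_free_complex_eq_bounded_complex:
  assumes fin: "\<And>i. i \<in> {1..m} \<Longrightarrow> finite (V i)" and disj: "disjoint_family_on V {1..m}"
    and j: "j \<in> {1..m}" and small: "\<And>i. i \<in> {1..m} \<Longrightarrow> i \<noteq> j \<Longrightarrow> card (V i) \<le> t - t div 2"
    and t: "t > 0"
  shows "path_free_complex t (complete_multipartite m V) =
    bounded_complex (\<Union>i\<in>{1..m}. V i) (- V j) (t - 1) (t div 2)"
proof -
  have finU: "finite (\<Union>i\<in>{1..m}. V i)" using fin by blast
  have "i = j" if F: "F \<subseteq> (\<Union>i\<in>{1..m}. V i)" "\<not> card F < t" "i \<in> {1..m}" "card (F - V i) < t div 2" for F i
  proof (rule ccontr)
    assume "i \<noteq> j"
    have "card F = card (F \<inter> V i) + card (F - V i)"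
      using card_Int_Diff finite_subset[OF F(1) finU] by blast
    moreover have "card (F \<inter> V i) \<le> card (V i)" using fin[OF F(3)] by (intro card_mono) auto
    ultimately show False using small[OF F(3) \<open>i \<noteq> j\<close>] F(2,4) by linarith
  qed
  then have bounds: "card F < t \<or> (\<exists>i\<in>{1..m}. card (F - V i) < t div 2) \<longleftrightarrow>
      card F \<le> t - 1 \<or> card (F \<inter> - V j) < t div 2" if "F \<subseteq> (\<Union>i\<in>{1..m}. V i)" for F
    using that j t unfolding Diff_eq[symmetric] by (metis Suc_pred' less_Suc_eq_le)
  have "path_free_complex t (complete_multipartite m V) =
      {F. F \<subseteq> (\<Union>i\<in>{1..m}. V i) \<and> (card F < t \<or> (\<exists>i\<in>{1..m}. card (F - V i) < t div 2))}"
    using fin disj by (rule path_free_complex_multipartite)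
  also have "\<dots> = bounded_complex (\<Union>i\<in>{1..m}. V i) (- V j) (t - 1) (t div 2)"
    unfolding bounded_complex_def by (intro Collect_cong conj_cong refl bounds)
  finally show ?thesis .
qed

theorem theorem1p1:
  fixes m t :: nat and n :: "nat \<Rightarrow> nat" and V :: "nat \<Rightarrow> 'a::linorder set"
    and G :: "'a graph"
  assumes "m \<ge> 2"
    and "\<And>i. i \<in> {1..m} \<Longrightarrow> n i > 0"
    and "mono_on {1..m} n"
    and "\<And>i. i \<in> {1..m} \<Longrightarrow> finite (V i) \<and> card (V i) = n i"
    and "disjoint_family_on V {1..m}"
    and "G = complete_multipartite m V"
    and "t \<ge> 2"
  shows "(int t \<ge> 2 * int (n (m - 1)) - 1 \<longleftrightarrow> vertex_decomposable (path_free_complex t G)) \<and>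
         (vertex_decomposable (path_free_complex t G) \<longleftrightarrow> shellable (path_free_complex t G)) \<and>
         (shellable (path_free_complex t G) \<longleftrightarrow>
            sequentially_cohen_macaulay TYPE('k::field) (path_free_complex t G))"
proof (cases "int t \<ge> 2 * int (n (m - 1)) - 1")
  case True
  let ?U = "\<Union>i\<in>{1..m}. V i"
  have finU: "finite ?U" using assms(4) by blast
  have "card (V i) \<le> t - t div 2" if i: "i \<in> {1..m}" "i \<noteq> m" for i
  proof -
    have "n i \<le> n (m - 1)" using i assms(1) by (intro mono_onD[OF assms(3)]) auto
    then show ?thesis using assms(4)[OF i(1)] True by linarith
  qed
  then have "path_free_complex t G = bounded_complex ?U (- V m) (t - 1) (t div 2)"
    unfolding assms(6) using assms(1,4,5,7)
    by (intro path_free_complex_eq_bounded_complex) auto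
  then show ?thesis
    using True vertex_decomposable_bounded_complex[OF finU]
      vertex_decomposable_imp_shellable sequentially_cohen_macaulay_bounded_complex[OF finU]
    by metis
next
  case False
  have "n (m - 1) \<le> n m" using assms(1) by (intro mono_onD[OF assms(3)]) auto
  moreover have "card (V m) = n m" "card (V (m - 1)) = n (m - 1)" using assms(1,4) by simp_all
  moreover have "t - t div 2 < n (m - 1)" using False by linarith
  ultimately have large: "t - t div 2 < card (V m)" "t - t div 2 < card (V (m - 1))" by simp_all
  interpret two_large_parts "\<Union>i\<in>{1..m}. V i" "{1..m}" V t m "m - 1"
    using assms(1,4,5,7) large by unfold_locales auto
  have "path_free_complex t G = D"
    unfolding assms(6) using assms(4,5) by (intro path_free_complex_multipartite) auto
  then show ?thesis
    using False not_shellable not_sequentially_cohen_macaulay vertex_decomposable_imp_shellable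
    by metis
qed

end
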